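(* Assume $\Delta_T\to\infty$, $T/\Delta_T\to\infty$ as $T\to\infty$, and $T/\Delta_T^{5/4}=o\big((\log(T/\Delta_T))^{-1/4}\big)$. Then for every $\vartheta\in\Theta$ the family $(\mathcal E^{T,\Delta_T})_{T>0}$ satisfies the LAN property at $\vartheta$ with normalisation $I_{T,\infty}(\vartheta)=\dfrac{T\Delta_T^{-1}}{2\vartheta^2}$.
   Context: Model: $\Theta\subseteq(0,\infty)$ open. Under $\mathbb P_\vartheta$, $X_t=\sum_{i=1}^{N_t}\varepsilon_i$ ($X_0=0$), $(N_t)$ homogeneous Poisson of intensity $\vartheta$, $\varepsilon_i$ i.i.d. independent of $(N_t)$ with $\mathbb P(\varepsilon_i=\pm1)=1/2$. The experiment $\mathcal E^{T,\Delta}=\{\mathbb P^{T,\Delta}_\vartheta,\vartheta\in\Theta\}$ consists of the law of $(X_0,X_\Delta,\dots,X_{\lfloor T/\Delta\rfloor\Delta})$. LAN: the family satisfies LAN at $\vartheta$ with normalisation $I_T(\vartheta)>0$ if for every $v$ with $\vartheta+vI_T(\vartheta)^{-1/2}\in\Theta$, $\frac{d\mathbb P^{T,\Delta_T}_{\vartheta+vI_T(\vartheta)^{-1/2}}}{d\mathbb P^{T,\Delta_T}_\vartheta}=\exp(v\xi_T-\tfrac12v^2+r_T)$ with $\xi_T\to\mathcal N(0,1)$ in distribution and $r_T\to0$ in probability under $\mathbb P^{T,\Delta_T}_\vartheta$. *)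

theory Defs
  imports "HOL-Probability.Probability" "HOL-Library.Landau_Symbols"
begin

definition rademacher_pmf :: "int pmf" where
  "rademacher_pmf = map_pmf (\<lambda>b. if b then 1 else -1) (bernoulli_pmf (1/2))"

definition cpp_marginal :: "real \<Rightarrow> real \<Rightarrow> int pmf" where
  "cpp_marginal \<theta> t =
     bind_pmf (poisson_pmf (\<theta> * t)) (\<lambda>n. map_pmf sum_list (replicate_pmf n rademacher_pmf))"

fun partial_sums :: "int \<Rightarrow> int list \<Rightarrow> int list" where
  "partial_sums s [] = [s]"
| "partial_sums s (y # ys) = s # partial_sums (s + y) ys"

text \<open>Law P^{T,Delta}_theta of (X_0, X_Delta, ..., X_{floor(T/Delta) Delta}): X_0 = 0 and
  the increments over the grid are i.i.d. with law cpp_marginal theta Delta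
  (independent stationary increments of the compound Poisson process).\<close>
definition cpp_obs :: "real \<Rightarrow> real \<Rightarrow> real \<Rightarrow> int list pmf" where
  "cpp_obs T \<Delta> \<theta> =
     map_pmf (partial_sums 0) (replicate_pmf (nat \<lfloor>T / \<Delta>\<rfloor>) (cpp_marginal \<theta> \<Delta>))"

definition conv_in_distr ::
  "'i filter \<Rightarrow> ('i \<Rightarrow> 'a pmf) \<Rightarrow> ('i \<Rightarrow> 'a \<Rightarrow> real) \<Rightarrow> real measure \<Rightarrow> bool" where
  "conv_in_distr F P \<xi> \<mu> \<longleftrightarrow>
     (\<forall>x. isCont (cdf \<mu>) x \<longrightarrow>
        ((\<lambda>T. measure_pmf.prob (P T) {\<omega>. \<xi> T \<omega> \<le> x}) \<longlongrightarrow> cdf \<mu> x) F)"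

definition LAN ::
  "real set \<Rightarrow> (real \<Rightarrow> real \<Rightarrow> 'a pmf) \<Rightarrow> real \<Rightarrow> (real \<Rightarrow> real) \<Rightarrow> bool" where
  "LAN \<Theta> P \<theta> I \<longleftrightarrow>
     (\<forall>\<^sub>F T in at_top. I T > 0) \<and>
     (\<exists>\<xi> :: real \<Rightarrow> 'a \<Rightarrow> real.
        conv_in_distr at_top (\<lambda>T. P T \<theta>) \<xi> std_normal_distribution \<and>
        (\<forall>v::real. \<forall>\<epsilon>>0. \<forall>\<^sub>F T in at_top.
           \<theta> + v / sqrt (I T) \<in> \<Theta> \<longrightarrow>
           measure_pmf.prob (P T \<theta>)
             {\<omega>. \<bar>ln (pmf (P T (\<theta> + v / sqrt (I T))) \<omega> / pmf (P T \<theta>) \<omega>)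
                   - (v * \<xi> T \<omega> - v\<^sup>2 / 2)\<bar> > \<epsilon>} < \<epsilon>))"

end

theory Submission
  imports Defs "HOL-Real_Asymp.Real_Asymp"
begin

text \<open>An increment of the compound Poisson process is a simple random walk at a Poisson time of
  mean \<open>l = \<theta> \<Delta>\<close>. Fourier inversion compares its weights with the Gaussian density of variance \<open>l\<close>, with
  absolute error \<open>O(l powr (-3/2))\<close>. With \<open>m = T / \<Delta>\<close> the growth condition yields \<open>m^4 / l \<longlonglongrightarrow> 0\<close>, and this makes
  the relative error summable over all increments \<open>k\<close> with \<open>k^2 \<le> 5 l ln m\<close>; by a Chernoff bound
  larger increments do not occur with probability tending to one.
  So the log-likelihood ratio may be computed as if the increments were Gaussian with unknown variance: at
  \<open>\<theta> (1 + h)\<close>, \<open>h = v sqrt (2 / m)\<close>, an increment contributes \<open>- ln (1 + h) / 2 + k^2 / (2 l) * (h / (1 + h))\<close>.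
  Expanding in \<open>h\<close>, the leading term is \<open>v\<close> times the normalised sum of \<open>k^2 / l - 1\<close>,
  which is asymptotically normal by the moment expansion of its characteristic function.\<close>

subsection \<open>The simple random walk at a Poisson time\<close>

definition walk :: "nat \<Rightarrow> int pmf" where
  "walk n = map_pmf sum_list (replicate_pmf n rademacher_pmf)"

text \<open>An increment depends on \<theta> and \<Delta> only through their product, the mean
  number \<open>l\<close> of jumps. Perturbing \<theta> by a factor \<open>1 + h\<close> therefore
  multiplies \<open>l\<close> by \<open>1 + h\<close>.\<close>

definition poisson_walk :: "real \<Rightarrow> int pmf" where
  "poisson_walk l = bind_pmf (poisson_pmf l) walk"

lemma cpp_marginal_eq: "cpp_marginal \<theta> t = poisson_walk (\<theta> * t)"
  by (simp add: cpp_marginal_def poisson_walk_def walk_def[abs_def])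

lemma walk_0: "walk 0 = return_pmf 0"
  by (simp add: walk_def)

lemma walk_Suc: "walk (Suc n) = bind_pmf rademacher_pmf (\<lambda>e. map_pmf (\<lambda>x. e + x) (walk n))"
  by (simp add: walk_def map_pmf_def bind_assoc_pmf bind_return_pmf)

lemma set_rademacher: "set_pmf rademacher_pmf = {1, -1}"
  by (auto simp: rademacher_pmf_def set_pmf_bernoulli image_iff)

lemma pmf_rademacher: "pmf rademacher_pmf 1 = 1/2" "pmf rademacher_pmf (-1) = 1/2"
proof -
  have inj: "inj (\<lambda>b. if b then 1 else -1 :: int)"
    by (auto simp: inj_def)
  show "pmf rademacher_pmf 1 = 1/2" "pmf rademacher_pmf (-1) = 1/2"
    using pmf_map_inj'[OF inj, of "bernoulli_pmf (1/2)" True] pmf_map_inj'[OF inj, of "bernoulli_pmf (1/2)" False]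
    by (simp_all add: rademacher_pmf_def)
qed

lemma finite_set_walk [simp]: "finite (set_pmf (walk n))"
  by (induction n) (auto simp: walk_0 walk_Suc set_rademacher)

lemma integrable_walk [simp]: "integrable (measure_pmf (walk n)) (f :: int \<Rightarrow> real)"
  by (simp add: integrable_measure_pmf_finite)

text \<open>Conditioning on the first step. The recursion for the weights, the even moments and the
  moment generating function are all derived from this identity.\<close>

lemma expectation_walk_Suc:
  fixes f :: "int \<Rightarrow> real"
  shows "measure_pmf.expectation (walk (Suc n)) f =
    (measure_pmf.expectation (walk n) (\<lambda>x. f (x + 1)) + measure_pmf.expectation (walk n) (\<lambda>x. f (x - 1))) / 2"
  unfolding walk_Suc
  by (subst pmf_expectation_bind[of "{1, -1}"]) (auto simp: set_rademacher pmf_rademacher add.commute field_simps)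

lemma pmf_walk_Suc: "pmf (walk (Suc n)) k = (pmf (walk n) (k - 1) + pmf (walk n) (k + 1)) / 2"
proof -
  have *: "pmf (walk m) j = measure_pmf.expectation (walk m) (indicator {j})" for m j
    by (simp add: measure_pmf_single)
  have **: "(\<lambda>x. indicator {k} (x + 1) :: real) = indicator {k - 1}"
    "(\<lambda>x. indicator {k} (x - 1) :: real) = indicator {k + 1}"
    by (auto simp: fun_eq_iff indicator_def)
  show ?thesis
    unfolding * expectation_walk_Suc ** by simp
qed

lemma walk_moment2: "measure_pmf.expectation (walk n) (\<lambda>x. (real_of_int x)^2) = real n"
  by (induction n) (simp_all add: walk_0 expectation_walk_Suc power2_eq_square algebra_simps)

lemma walk_moment4:
  "measure_pmf.expectation (walk n) (\<lambda>x. (real_of_int x)^4) = 3 * (real n)^2 - 2 * real n"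
proof (induction n)
  case (Suc n)
  \<comment> \<open>Odd powers cancel in the average over the two shifts, so the even moments
    satisfy a closed recursion.\<close>
  have *: "(\<lambda>x. (real_of_int (x + 1))^4) = (\<lambda>x. real_of_int x^4 + 4 * real_of_int x^3 + 6 * real_of_int x^2 + 4 * real_of_int x + 1)"
    "(\<lambda>x. (real_of_int (x - 1))^4) = (\<lambda>x. real_of_int x^4 - 4 * real_of_int x^3 + 6 * real_of_int x^2 - 4 * real_of_int x + 1)"
    by (auto simp: fun_eq_iff power4_eq_xxxx power3_eq_cube power2_eq_square algebra_simps)
  show ?case
    unfolding expectation_walk_Suc *
    by (simp add: Suc walk_moment2) (simp add: power2_eq_square algebra_simps)
qed (simp add: walk_0)

lemma walk_moment6:
  "measure_pmf.expectation (walk n) (\<lambda>x. (real_of_int x)^6) = 15 * (real n)^3 - 30 * (real n)^2 + 16 * real n"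
proof (induction n)
  case (Suc n)
  have *: "(\<lambda>x. (real_of_int (x + 1))^6) = (\<lambda>x. real_of_int x^6 + 6 * real_of_int x^5 + 15 * real_of_int x^4 + 20 * real_of_int x^3 + 15 * real_of_int x^2 + 6 * real_of_int x + 1)"
    "(\<lambda>x. (real_of_int (x - 1))^6) = (\<lambda>x. real_of_int x^6 - 6 * real_of_int x^5 + 15 * real_of_int x^4 - 20 * real_of_int x^3 + 15 * real_of_int x^2 - 6 * real_of_int x + 1)"
    by (auto simp: fun_eq_iff numeral_eq_Suc algebra_simps)
  show ?case
    unfolding expectation_walk_Suc *
    by (simp add: Suc walk_moment2 walk_moment4) (simp add: power2_eq_square power3_eq_cube algebra_simps)
qed (simp add: walk_0)

lemma walk_mgf: "measure_pmf.expectation (walk n) (\<lambda>x. exp (s * real_of_int x)) = cosh s ^ n"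
proof (induction n)
  case (Suc n)
  have *: "(\<lambda>x. exp (s * real_of_int (x + 1))) = (\<lambda>x. exp s * exp (s * real_of_int x))"
    "(\<lambda>x. exp (s * real_of_int (x - 1))) = (\<lambda>x. exp (-s) * exp (s * real_of_int x))"
    by (auto simp: fun_eq_iff exp_add[symmetric] algebra_simps)
  show ?case
    unfolding expectation_walk_Suc * by (simp add: Suc cosh_def field_simps)
qed (simp add: walk_0)

text \<open>Conditioning on the number of jumps. For nonnegative \<open>f\<close> the sum and the
  integral may be exchanged freely, so convergence of the series delivers integrability and the
  value together.\<close>

lemma poisson_walk_expectation:
  fixes f :: "int \<Rightarrow> real"
  assumes "l > 0" and f: "\<And>x. f x \<ge> 0"
    and s: "(\<lambda>n. l ^ n / fact n * exp (-l) * measure_pmf.expectation (walk n) f) sums s"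
  shows "has_bochner_integral (measure_pmf (poisson_walk l)) f s"
proof (rule has_bochner_integral_nn_integral)
  let ?E = "\<lambda>n. measure_pmf.expectation (walk n) f"
  have E: "?E n \<ge> 0" for n
    using f by (intro integral_nonneg_AE) auto
  show "s \<ge> 0"
    using \<open>l > 0\<close> E by (intro sums_le[OF _ sums_zero s]) auto
  have "(\<integral>\<^sup>+x. ennreal (f x) \<partial>poisson_walk l) = (\<integral>\<^sup>+n. ennreal (?E n) \<partial>poisson_pmf l)"
    unfolding poisson_walk_def nn_integral_bind_pmf
    using f by (intro nn_integral_cong nn_integral_eq_integral) auto
  also have "\<dots> = (\<Sum>n. ennreal (l ^ n / fact n * exp (-l) * ?E n))"
    unfolding nn_integral_measure_pmf nn_integral_count_space_nat
    using \<open>l > 0\<close> E by (simp add: ennreal_mult'[symmetric])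
  also have "\<dots> = ennreal s"
    using s \<open>l > 0\<close> E by (subst suminf_ennreal2) (auto simp: sums_iff)
  finally show "(\<integral>\<^sup>+x. ennreal (f x) \<partial>poisson_walk l) = ennreal s" .
qed (use f in auto)

text \<open>The Stein-Chen identity E[N g(N)] = l E[g(N + 1)] for a Poisson variable N, by
  cancelling \<open>n\<close> against the factorial. The term at \<open>n = 0\<close> vanishes, so
  the index shift costs nothing.\<close>

lemma poisson_stein:
  fixes g :: "nat \<Rightarrow> real"
  assumes "(\<lambda>n. l ^ n / fact n * exp (-l) * g (Suc n)) sums s"
  shows "(\<lambda>n. l ^ n / fact n * exp (-l) * (real n * g n)) sums (l * s)"
proof -
  have "(\<lambda>n. l * (l ^ n / fact n * exp (-l) * g (Suc n))) sums (l * s)"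
    using assms by (rule sums_mult)
  also have "(\<lambda>n. l * (l ^ n / fact n * exp (-l) * g (Suc n))) =
      (\<lambda>n. l ^ Suc n / fact (Suc n) * exp (-l) * (real (Suc n) * g (Suc n)))"
    by (auto simp: fun_eq_iff divide_simps)
  finally show ?thesis
    by (subst (asm) sums_Suc_iff) simp
qed

lemma poisson_sums_power:
  fixes l x :: real
  shows "(\<lambda>n. l ^ n / fact n * exp (-l) * x ^ n) sums exp (l * (x - 1))"
proof -
  have "(\<lambda>n. exp (-l) * ((l * x) ^ n /\<^sub>R fact n)) sums (exp (-l) * exp (l * x))"
    by (intro sums_mult exp_converges)
  then show ?thesis
    by (simp add: exp_add[symmetric] power_mult_distrib field_simps)
qed

text \<open>The Stein-Chen identity with g equal to 1, n and n^2 raises the power by one each time,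
  since g(n + 1) expands into moments already known.\<close>

lemma poisson_moments:
  fixes l :: real
  shows "(\<lambda>n. l ^ n / fact n * exp (-l) * real n) sums l"
    and "(\<lambda>n. l ^ n / fact n * exp (-l) * (real n)^2) sums (l^2 + l)"
    and "(\<lambda>n. l ^ n / fact n * exp (-l) * (real n)^3) sums (l^3 + 3 * l^2 + l)"
proof -
  have 0: "(\<lambda>n. l ^ n / fact n * exp (-l) * 1) sums 1"
    using poisson_sums_power[of l 1] by simp
  show 1: "(\<lambda>n. l ^ n / fact n * exp (-l) * real n) sums l"
    using poisson_stein[of l "\<lambda>_. 1" 1] 0 by simp
  have "(\<lambda>n. l ^ n / fact n * exp (-l) * real (Suc n)) sums (l + 1)"
    using sums_add[OF 1 0] by (simp add: add_divide_distrib algebra_simps)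
  from poisson_stein[of l real, OF this]
  show 2: "(\<lambda>n. l ^ n / fact n * exp (-l) * (real n)^2) sums (l^2 + l)"
    by (simp add: power2_eq_square algebra_simps)
  have "(\<lambda>n. l ^ n / fact n * exp (-l) * (real (Suc n))^2) sums ((l^2 + l) + 2 * l + 1)"
    using sums_add[OF sums_add[OF 2 sums_mult[OF 1, of 2]] 0] by (simp add: power2_eq_square add_divide_distrib algebra_simps)
  from poisson_stein[of l "\<lambda>n. (real n)^2", OF this]
  show "(\<lambda>n. l ^ n / fact n * exp (-l) * (real n)^3) sums (l^3 + 3 * l^2 + l)"
    by (simp add: power2_eq_square power3_eq_cube algebra_simps)
qed

lemma poisson_walk_moment2:
  "l > 0 \<Longrightarrow> has_bochner_integral (measure_pmf (poisson_walk l)) (\<lambda>x. (real_of_int x)^2) l"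
  using poisson_moments(1) by (intro poisson_walk_expectation) (simp_all add: walk_moment2)

lemma poisson_walk_moment4:
  assumes "l > 0"
  shows "has_bochner_integral (measure_pmf (poisson_walk l)) (\<lambda>x. (real_of_int x)^4) (3 * l^2 + l)"
proof (rule poisson_walk_expectation)
  show "(\<lambda>n. l ^ n / fact n * exp (-l) * measure_pmf.expectation (walk n) (\<lambda>x. (real_of_int x)^4)) sums (3 * l^2 + l)"
    using sums_diff[OF sums_mult[OF poisson_moments(2), of 3] sums_mult[OF poisson_moments(1), of 2], of l l]
    by (simp add: walk_moment4 algebra_simps)
qed (use assms in auto)

lemma poisson_walk_moment6:
  assumes "l > 0"
  shows "has_bochner_integral (measure_pmf (poisson_walk l)) (\<lambda>x. (real_of_int x)^6) (15 * l^3 + 15 * l^2 + l)"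
proof (rule poisson_walk_expectation)
  show "(\<lambda>n. l ^ n / fact n * exp (-l) * measure_pmf.expectation (walk n) (\<lambda>x. (real_of_int x)^6)) sums (15 * l^3 + 15 * l^2 + l)"
    using sums_add[OF sums_diff[OF sums_mult[OF poisson_moments(3), of 15] sums_mult[OF poisson_moments(2), of 30], of l l]
       sums_mult[OF poisson_moments(1), of 16 l]]
    by (simp add: walk_moment6 algebra_simps)
qed (use assms in auto)

lemma poisson_walk_mgf:
  "l > 0 \<Longrightarrow> has_bochner_integral (measure_pmf (poisson_walk l)) (\<lambda>x. exp (s * real_of_int x)) (exp (l * (cosh s - 1)))"
  using poisson_sums_power by (intro poisson_walk_expectation) (simp_all add: walk_mgf)

subsection \<open>Tail bound and local limit theorem\<close>

text \<open>The bound on \<open>exp (-s)\<close> comes from the quadratic lower bound on its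
  reciprocal, because (1 + s + s^2/2) (1 - s + s^2/2) = 1 + s^4/4 is at least 1. The inequality
  serves the Chernoff bound below.\<close>

lemma cosh_le_one_plus_square:
  fixes s :: real
  assumes "0 \<le> s" "s \<le> 1"
  shows "cosh s \<le> 1 + s^2"
proof -
  have 1: "exp s \<le> 1 + s + s^2"
    using assms by (rule exp_bound)
  have "1 + s + s^2 / 2 \<le> exp s"
    using assms by (intro exp_lower_Taylor_quadratic)
  moreover have "(1 + s + s^2 / 2) * (1 - s + s^2 / 2) \<ge> 1"
  proof -
    have "(1 + s + s^2 / 2) * (1 - s + s^2 / 2) = 1 + (s^2)^2 / 4"
      by (simp add: power2_eq_square algebra_simps)
    then show ?thesis by simp
  qed
  moreover have "1 - s + s^2 / 2 \<ge> 0"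
    using assms by simp
  ultimately have "exp s * (1 - s + s^2 / 2) \<ge> 1"
    by (meson mult_right_mono order_trans)
  then have 2: "exp (-s) \<le> 1 - s + s^2 / 2"
    by (simp add: exp_minus field_simps)
  obtain q where q: "q = s^2" "q \<ge> 0"
    by simp
  show ?thesis
    using 1 2 q(2) unfolding q(1)[symmetric] by (simp add: cosh_def)
qed

text \<open>Chernoff's bound for both tails at once: the sum of the exponentials with parameters
  \<open>s\<close> and \<open>-s\<close>, scaled by \<open>exp (- s * x)\<close>, dominates the
  indicator of the event.\<close>

lemma poisson_walk_tail:
  assumes "l > 0" "0 \<le> x" "x \<le> 2 * l"
  shows "measure_pmf.prob (poisson_walk l) {k. \<bar>real_of_int k\<bar> > x} \<le> 2 * exp (- (x^2 / (4 * l)))"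
proof -
  \<comment> \<open>This \<open>s\<close> minimises \<open>l * s^2 - s * x\<close>. The condition
    \<open>x \<le> 2 * l\<close> is exactly \<open>s \<le> 1\<close>.\<close>
  define s where "s = x / (2 * l)"
  have s: "0 \<le> s" "s \<le> 1"
    using assms by (auto simp: s_def field_simps)
  let ?g = "\<lambda>k. exp (- s * x) * (exp (s * real_of_int k) + exp ((-s) * real_of_int k))"
  have g: "has_bochner_integral (measure_pmf (poisson_walk l)) ?g
     (exp (- s * x) * (exp (l * (cosh s - 1)) + exp (l * (cosh (-s) - 1))))"
    using assms by (intro has_bochner_integral_mult_right has_bochner_integral_add poisson_walk_mgf) auto
  have "measure_pmf.prob (poisson_walk l) {k. \<bar>real_of_int k\<bar> > x} =
      measure_pmf.expectation (poisson_walk l) (indicator {k. \<bar>real_of_int k\<bar> > x})"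
    by simp
  also have "\<dots> \<le> measure_pmf.expectation (poisson_walk l) ?g"
  proof (rule integral_mono)
    fix k :: int
    show "indicator {k. \<bar>real_of_int k\<bar> > x} k \<le> ?g k"
    proof (cases "\<bar>real_of_int k\<bar> > x")
      case True
      have "1 \<le> exp (- s * x) * exp (s * \<bar>real_of_int k\<bar>)"
        using True s by (simp add: exp_add[symmetric] mult_left_mono)
      also have "\<dots> \<le> ?g k"
        by (intro mult_left_mono) (auto simp: abs_if)
      finally show ?thesis using True by simp
    qed (auto intro!: mult_nonneg_nonneg add_nonneg_nonneg)
  next
    show "integrable (measure_pmf (poisson_walk l)) (indicator {k. \<bar>real_of_int k\<bar> > x} :: int \<Rightarrow> real)"
      by (intro measure_pmf.integrable_const_bound[where B = 1]) auto
  qed (use g in \<open>simp add: has_bochner_integral_iff\<close>)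
  also have "\<dots> = exp (- s * x) * (exp (l * (cosh s - 1)) + exp (l * (cosh (-s) - 1)))"
    using g by (simp only: has_bochner_integral_iff)
  also have "\<dots> = 2 * exp (l * (cosh s - 1) - s * x)"
    by (simp add: exp_diff exp_minus exp_add field_simps)
  also have "\<dots> \<le> 2 * exp (- (x^2 / (4 * l)))"
  proof -
    have "l * (cosh s - 1) \<le> l * s^2"
      using cosh_le_one_plus_square[OF s] \<open>l > 0\<close> by (intro mult_left_mono) auto
    also have "l * s^2 = x^2 / (4 * l)"
      using \<open>l > 0\<close> by (simp add: s_def power2_eq_square)
    finally have "l * (cosh s - 1) \<le> x^2 / (4 * l)" .
    moreover have "s * x = 2 * (x^2 / (4 * l))"
      by (simp add: s_def power2_eq_square)
    ultimately show ?thesis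
      by simp
  qed
  finally show ?thesis .
qed

lemma cos_quadratic_lower: "cos t \<ge> 1 - t^2 / 2" for t :: real
proof -
  have "\<bar>sin (t/2)\<bar> \<le> \<bar>t/2\<bar>"
    by (rule abs_sin_x_le_abs_x)
  then have "(sin (t/2))^2 \<le> (t/2)^2"
    by (rule abs_le_square_iff[THEN iffD1])
  then show ?thesis
    using cos_double_sin[of "t/2"] by (simp add: power_divide)
qed

lemma cos_quartic_upper: "cos t \<le> 1 - t^2 / 2 + t^4 / 24" for t :: real
proof -
  obtain u where "cos t = (\<Sum>m<4. cos_coeff m * t ^ m) + cos (u + 1/2 * real 4 * pi) / fact 4 * t ^ 4"
    using Maclaurin_cos_expansion[of t 4] by auto
  also have "cos (u + 1/2 * real 4 * pi) = cos u"
    by simp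
  also have "(\<Sum>m<4. cos_coeff m * t ^ m) = 1 - t^2 / 2"
  proof -
    have "{..<4} = {0, 1, 2, 3 :: nat}" by auto
    then show ?thesis by (simp add: cos_coeff_def)
  qed
  also have "cos u / fact 4 * t ^ 4 \<le> 1 / 24 * t ^ 4"
    by (intro mult_right_mono) (auto simp: fact_numeral)
  finally show ?thesis by simp
qed

lemma integrable_indicator_continuous:
  fixes f :: "real \<Rightarrow> real"
  shows "continuous_on {a..b} f \<Longrightarrow> integrable lborel (\<lambda>t. indicator {a..b} t * f t)"
  using borel_integrable_compact[of "{a..b}" f] by simp

text \<open>Fourier inversion on the integers; \<open>cos t ^ n\<close> is the characteristic
  function of the symmetric walk. In the induction, averaging the weights of the two neighbours
  corresponds to cos((k-1)t) + cos((k+1)t) = 2 cos t cos(kt).\<close>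

lemma pmf_walk_fourier:
  "2 * pi * pmf (walk n) k = (\<integral>t. indicator {-pi..pi} t * (cos t ^ n * cos (real_of_int k * t)) \<partial>lborel)"
proof (induction n arbitrary: k)
  case 0
  show ?case
  proof (cases "k = 0")
    case True
    then show ?thesis by (simp add: walk_0)
  next
    case False
    have "(\<integral>t. cos (real_of_int k * t) * indicator {-pi..pi} t \<partial>lborel)
      = sin (real_of_int k * pi) / real_of_int k - sin (real_of_int k * (-pi)) / real_of_int k"
      using False
      by (intro integral_FTC_Icc_real[where F = "\<lambda>t. sin (real_of_int k * t) / real_of_int k"])
         (auto intro!: derivative_eq_intros continuous_intros)
    also have "\<dots> = 0"
      by (simp add: sin_npi_int mult.commute)
    finally show ?thesis
      using False by (simp add: walk_0 mult.commute)
  qed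
next
  case (Suc n)
  have int: "integrable lborel (\<lambda>t. indicator {-pi..pi} t * (cos t ^ n * cos (real_of_int j * t)))" for j
    by (intro integrable_indicator_continuous continuous_intros)
  have "2 * pi * pmf (walk (Suc n)) k =
     (2 * pi * pmf (walk n) (k - 1) + 2 * pi * pmf (walk n) (k + 1)) / 2"
    by (simp add: pmf_walk_Suc field_simps)
  also have "\<dots> = (\<integral>t. (indicator {-pi..pi} t * (cos t ^ n * cos (real_of_int (k - 1) * t))
      + indicator {-pi..pi} t * (cos t ^ n * cos (real_of_int (k + 1) * t))) / 2 \<partial>lborel)"
    unfolding Suc.IH using int[of "k - 1"] int[of "k + 1"] by (subst integral_divide_zero, subst Bochner_Integration.integral_add) auto
  also have "\<dots> = (\<integral>t. indicator {-pi..pi} t * (cos t ^ Suc n * cos (real_of_int k * t)) \<partial>lborel)"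
    by (intro Bochner_Integration.integral_cong)
       (auto simp: indicator_def algebra_simps cos_add cos_diff)
  finally show ?case .
qed

text \<open>The previous inversion formula is averaged over the Poisson number of jumps. The
  \<open>n\<close>-th term is dominated by its Poisson weight on the compact interval, which
  justifies exchanging sum and integral, and the powers of \<open>cos t\<close> add up to
  \<open>exp (l * (cos t - 1))\<close>.\<close>

lemma pmf_poisson_walk_fourier:
  assumes "l > 0"
  shows "2 * pi * pmf (poisson_walk l) k =
    (\<integral>t. indicator {-pi..pi} t * (exp (- (l * (1 - cos t))) * cos (real_of_int k * t)) \<partial>lborel)"
proof -
  let ?p = "\<lambda>n. l ^ n / fact n * exp (-l)"
  let ?f = "\<lambda>n t. ?p n * (indicator {-pi..pi} t * (cos t ^ n * cos (real_of_int k * t)))"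
  have p: "?p sums 1"
    using poisson_sums_power[of l 1] by simp
  have p0: "?p n \<ge> 0" for n
    using assms by simp
  have int: "integrable lborel (?f n)" for n
    by (intro integrable_mult_right integrable_indicator_continuous continuous_intros)
  have bd: "norm (?f n t) \<le> ?p n * indicator {-pi..pi} t" for n t
  proof -
    have "\<bar>cos t ^ n\<bar> * \<bar>cos (real_of_int k * t)\<bar> \<le> 1 * 1"
      by (intro mult_mono) (auto simp: power_abs power_le_one)
    from mult_left_mono[OF this p0[of n]] show ?thesis
      using assms by (auto simp: abs_mult indicator_def)
  qed
  have "(\<lambda>n. integral\<^sup>L lborel (?f n)) sums (\<integral>t. (\<Sum>n. ?f n t) \<partial>lborel)"
  proof (rule sums_integral[OF int])
    show "AE t in lborel. summable (\<lambda>n. norm (?f n t))"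
    proof (rule AE_I2)
      fix t
      show "summable (\<lambda>n. norm (?f n t))"
        using bd by (intro summable_comparison_test[OF _ summable_mult2[OF sums_summable[OF p], of "indicator {-pi..pi} t"]]) auto
    qed
    show "summable (\<lambda>n. \<integral>t. norm (?f n t) \<partial>lborel)"
    proof (rule summable_comparison_test)
      have "norm (\<integral>t. norm (?f n t) \<partial>lborel) \<le> ?p n * (2 * pi)" for n
      proof -
        have "norm (\<integral>t. norm (?f n t) \<partial>lborel) = (\<integral>t. norm (?f n t) \<partial>lborel)"
          by (simp add: integral_nonneg_AE)
        also have "\<dots> \<le> (\<integral>t. ?p n * indicator {-pi..pi} t \<partial>lborel)"
          using bd int by (intro integral_mono integrable_norm) auto
        also have "\<dots> = ?p n * (2 * pi)" by simp
        finally show ?thesis .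
      qed
      then show "\<exists>N. \<forall>n\<ge>N. norm (\<integral>t. norm (?f n t) \<partial>lborel) \<le> ?p n * (2 * pi)"
        by blast
      show "summable (\<lambda>n. ?p n * (2 * pi))"
        by (intro summable_mult2 sums_summable[OF p])
    qed
  qed
  also have "(\<lambda>n. integral\<^sup>L lborel (?f n)) = (\<lambda>n. 2 * pi * (?p n * pmf (walk n) k))"
    by (simp add: pmf_walk_fourier[symmetric] fun_eq_iff)
  also have "(\<lambda>t. \<Sum>n. ?f n t) = (\<lambda>t. indicator {-pi..pi} t * (exp (- (l * (1 - cos t))) * cos (real_of_int k * t)))"
  proof
    fix t
    have "(\<lambda>n. (?p n * cos t ^ n) * (indicator {-pi..pi} t * cos (real_of_int k * t))) sums
        (exp (l * (cos t - 1)) * (indicator {-pi..pi} t * cos (real_of_int k * t)))"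
      by (intro sums_mult2 poisson_sums_power)
    then show "(\<Sum>n. ?f n t) = indicator {-pi..pi} t * (exp (- (l * (1 - cos t))) * cos (real_of_int k * t))"
      by (simp add: sums_iff algebra_simps)
  qed
  finally have S: "(\<lambda>n. 2 * pi * (?p n * pmf (walk n) k)) sums
      (\<integral>t. indicator {-pi..pi} t * (exp (- (l * (1 - cos t))) * cos (real_of_int k * t)) \<partial>lborel)"
    (is "_ sums ?I") .
  from sums_mult[OF this, of "1 / (2 * pi)"] have S': "(\<lambda>n. ?p n * pmf (walk n) k) sums (?I / (2 * pi))"
    by simp
  have "has_bochner_integral (measure_pmf (poisson_walk l)) (indicator {k} :: int \<Rightarrow> real) (?I / (2 * pi))"
    using assms S' by (intro poisson_walk_expectation) (auto simp: measure_pmf_single)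
  then have "pmf (poisson_walk l) k = ?I / (2 * pi)"
    by (simp add: has_bochner_integral_iff measure_pmf_single)
  then show ?thesis by simp
qed

text \<open>This is the real part of the characteristic function of the standard normal law at
  \<open>u / sqrt l\<close>, after the substitution x = \<open>sqrt l * t\<close>.\<close>

lemma gaussian_fourier:
  assumes "l > 0"
  shows "(\<integral>t. exp (- (l * t^2 / 2)) * cos (u * t) \<partial>lborel) = sqrt (2 * pi / l) * exp (- (u^2) / (2 * l))"
proof -
  interpret real_distribution std_normal_distribution
    by (rule real_dist_normal_dist)
  define w where "w = u / sqrt l"
  have int: "integrable std_normal_distribution (\<lambda>x. iexp (w * x))"
    by (intro integrable_iexp) auto
  have "exp (- (w^2) / 2) = Re (char std_normal_distribution w)"
    by (simp add: char_std_normal_distribution)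
  also have "\<dots> = (\<integral>x. cos (w * x) \<partial>std_normal_distribution)"
    unfolding char_def by (subst integral_Re[symmetric, OF int]) (simp add: Re_exp)
  also have "\<dots> = (\<integral>x. std_normal_density x * cos (w * x) \<partial>lborel)"
    by (subst integral_density) auto
  also have "\<dots> = sqrt l * (\<integral>x. std_normal_density (sqrt l * x) * cos (w * (sqrt l * x)) \<partial>lborel)"
    using assms by (subst lborel_integral_real_affine[of "sqrt l" _ 0]) auto
  also have "(\<lambda>x. std_normal_density (sqrt l * x) * cos (w * (sqrt l * x))) =
      (\<lambda>x. 1 / sqrt (2 * pi) * (exp (- (l * x^2 / 2)) * cos (u * x)))"
    using assms by (auto simp: fun_eq_iff std_normal_density_def w_def power_mult_distrib)
  finally have "exp (- (w^2) / 2) = sqrt l / sqrt (2 * pi) * (\<integral>t. exp (- (l * t^2 / 2)) * cos (u * t) \<partial>lborel)"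
    by simp
  then show ?thesis
    using assms by (simp add: w_def power_divide real_sqrt_divide field_simps)
qed

text \<open>Up to normalisation, the fourth moment of a centred normal law of variance
  \<open>6 / l\<close>. It evaluates the integral of the error bound in the local limit
  theorem.\<close>

lemma gaussian_fourth_moment:
  assumes "l > 0"
  shows "has_bochner_integral lborel (\<lambda>t. t^4 * exp (- (l * t^2 / 12))) (sqrt (12 * pi / l) * (108 / l^2))"
proof -
  define s where "s = sqrt (6 / l)"
  have s: "s > 0" "s^2 = 6 / l"
    using assms by (auto simp: s_def)
  have "has_bochner_integral lborel (\<lambda>t. sqrt (12 * pi / l) * (normal_density 0 s t * (t - 0)^(2*2)))
      (sqrt (12 * pi / l) * (fact (2*2) / ((2 / s^2)^2 * fact 2)))"
    by (intro has_bochner_integral_mult_right normal_moment_even s)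
  also have "fact (2*2) / ((2 / s^2)^2 * fact 2) = 108 / l^2"
    using assms by (simp add: s(2) fact_numeral power_divide)
  also have "(\<lambda>t. sqrt (12 * pi / l) * (normal_density 0 s t * (t - 0)^(2*2))) = (\<lambda>t. t^4 * exp (- (l * t^2 / 12)))"
    using assms by (auto simp: fun_eq_iff normal_density_def s(2) real_sqrt_divide real_sqrt_mult field_simps)
  finally show ?thesis .
qed

lemma exp_diff_bound:
  fixes a b :: real
  assumes "a \<le> b"
  shows "\<bar>exp (-a) - exp (-b)\<bar> \<le> (b - a) * exp (-a)"
proof -
  have "exp (-a) * (1 - (b - a)) \<le> exp (-a) * exp (- (b - a))"
    using exp_minus_ge[of "b - a"] by (intro mult_left_mono) auto
  also have "\<dots> = exp (-b)"
    by (simp add: exp_add[symmetric])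
  finally show ?thesis
    using assms by (simp add: algebra_simps)
qed

text \<open>On the interval the two exponents differ by at most \<open>l * t^4 / 24\<close> by
  Taylor's formula for the cosine, and both are at least \<open>l * t^2 / 12\<close>. Off the
  interval only the second exponential remains, and there the factor \<open>l / 24 * t^4\<close>
  exceeds 1.\<close>

lemma gaussian_phase_bound:
  fixes l t :: real
  assumes "l \<ge> 1"
  shows "\<bar>indicator {-pi..pi} t * exp (- (l * (1 - cos t))) - exp (- (l * t^2 / 2))\<bar>
    \<le> l / 24 * (t^4 * exp (- (l * t^2 / 12)))"
proof (cases "t \<in> {-pi..pi}")
  case True
  \<comment> \<open>With t^2 \<le> 10 the quartic Taylor bound leaves 1 - cos t \<ge> (1/2 - 10/24)
    t^2 = t^2/12, a Gaussian decay on the whole interval.\<close>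
  have pi2: "pi^2 \<le> 10"
  proof -
    have "pi^2 \<le> (3.16::real)^2"
      using pi_approx by (intro power_mono) auto
    then show ?thesis by (simp add: power2_eq_square)
  qed
  have "t^2 \<le> pi^2"
    using True by (intro abs_le_square_iff[THEN iffD1]) auto
  with pi2 have t2: "t^2 \<le> 10" by simp
  have le: "l * (1 - cos t) \<le> l * t^2 / 2"
    using mult_left_mono[OF cos_quadratic_lower[of t], of l] assms by (simp add: algebra_simps)
  have diff: "l * t^2 / 2 - l * (1 - cos t) \<le> l / 24 * t^4"
    using mult_left_mono[OF cos_quartic_upper[of t], of l] assms by (simp add: algebra_simps)
  have "t^2 * t^2 \<le> 10 * t^2"
    using t2 by (intro mult_right_mono) auto
  then have "t^4 / 24 \<le> 10 / 24 * t^2"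
    by (simp add: power4_eq_xxxx power2_eq_square)
  with cos_quartic_upper[of t] have "t^2 / 12 \<le> 1 - cos t"
    by simp
  then have low: "l * t^2 / 12 \<le> l * (1 - cos t)"
    using mult_left_mono[of "t^2 / 12" "1 - cos t" l] assms by simp
  have "\<bar>exp (- (l * (1 - cos t))) - exp (- (l * t^2 / 2))\<bar> \<le>
      (l * t^2 / 2 - l * (1 - cos t)) * exp (- (l * (1 - cos t)))"
    using le by (rule exp_diff_bound)
  also have "\<dots> \<le> (l / 24 * t^4) * exp (- (l * t^2 / 12))"
    using diff low assms by (intro mult_mono) auto
  finally show ?thesis
    using True by simp
next
  case False
  then have "\<bar>t\<bar> \<ge> 3"
    using pi_gt3 by auto
  then have "\<bar>t\<bar>^4 \<ge> 3^4"
    by (intro power_mono) auto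
  then have "t^4 \<ge> 24"
    by simp
  then have "l / 24 * t^4 \<ge> 1"
    using assms mult_mono[of 1 l 24 "t^4"] by simp
  moreover have "exp (- (l * t^2 / 2)) \<le> exp (- (l * t^2 / 12))"
    using assms by simp
  ultimately have "1 * exp (- (l * t^2 / 2)) \<le> (l / 24 * t^4) * exp (- (l * t^2 / 12))"
    using assms by (intro mult_mono) auto
  then show ?thesis
    using False by simp
qed

text \<open>The Fourier integrals of the walk and of the Gaussian density differ by at most the
  integral of the bound on the phases, of order \<open>l powr (-3/2)\<close>. Multiplication by
  \<open>sqrt (2 * pi * l)\<close> makes the error of order \<open>1 / l\<close>.\<close>

lemma poisson_walk_local_limit:
  assumes "l \<ge> 1"
  shows "\<bar>sqrt (2 * pi * l) * pmf (poisson_walk l) k - exp (- ((real_of_int k)^2 / (2 * l)))\<bar> \<le> 12 / l"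
proof -
  let ?c = "\<lambda>t. cos (real_of_int k * t)"
  let ?g = "\<lambda>t. indicator {-pi..pi} t * (exp (- (l * (1 - cos t))) * ?c t)"
  let ?h = "\<lambda>t. exp (- (l * t^2 / 2)) * ?c t"
  let ?B = "\<lambda>t. l / 24 * (t^4 * exp (- (l * t^2 / 12)))"
  have l: "l > 0" using assms by simp
  have B: "has_bochner_integral lborel ?B (l / 24 * (sqrt (12 * pi / l) * (108 / l^2)))"
    by (intro has_bochner_integral_mult_right gaussian_fourth_moment l)
  have ig: "integrable lborel ?g"
    by (intro integrable_indicator_continuous continuous_intros)
  have bd: "\<bar>?g t - ?h t\<bar> \<le> ?B t" for t
  proof -
    have "\<bar>?g t - ?h t\<bar> = \<bar>indicator {-pi..pi} t * exp (- (l * (1 - cos t))) - exp (- (l * t^2 / 2))\<bar> * \<bar>?c t\<bar>"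
      by (simp add: abs_mult[symmetric] algebra_simps)
    also have "\<dots> \<le> ?B t * 1"
      using assms by (intro mult_mono gaussian_phase_bound) auto
    finally show ?thesis by simp
  qed
  have id: "integrable lborel (\<lambda>t. ?g t - ?h t)"
  proof (rule Bochner_Integration.integrable_bound)
    show "integrable lborel ?B"
      using B by (simp add: has_bochner_integral_iff)
    show "AE t in lborel. norm (?g t - ?h t) \<le> norm (?B t)"
      using bd abs_ge_self order_trans by (intro AE_I2) (simp only: real_norm_def, blast)
  qed measurable
  have ih: "integrable lborel ?h"
    using Bochner_Integration.integrable_diff[OF ig id] by simp
  have "\<bar>(\<integral>t. ?g t \<partial>lborel) - (\<integral>t. ?h t \<partial>lborel)\<bar> = \<bar>\<integral>t. ?g t - ?h t \<partial>lborel\<bar>"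
    using ig ih by simp
  also have "\<dots> \<le> (\<integral>t. ?B t \<partial>lborel)"
    using B by (intro integral_abs_bound_integral id bd) (auto simp: has_bochner_integral_iff)
  also have "\<dots> = 9/2 * sqrt (12 * pi / l) / l"
    using B l by (simp add: has_bochner_integral_iff power2_eq_square)
  finally have main: "\<bar>2 * pi * pmf (poisson_walk l) k - sqrt (2 * pi / l) * exp (- ((real_of_int k)^2) / (2 * l))\<bar>
     \<le> 9/2 * sqrt (12 * pi / l) / l"
    unfolding pmf_poisson_walk_fourier[OF l] gaussian_fourier[OF l] .
  \<comment> \<open>Multiplying by \<open>r\<close> brings the weight to the scale
    \<open>sqrt (2 * pi * l)\<close> and removes the prefactor of the Gaussian term. The error
    constant becomes 9/2 times \<open>sqrt 6\<close>, which is below 12.\<close>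
  define r where "r = sqrt (l / (2 * pi))"
  have r0: "r \<ge> 0" using l by (simp add: r_def)
  have r1: "r * (2 * pi) = sqrt (2 * pi * l)"
    by (simp add: r_def real_sqrt_divide real_sqrt_mult field_simps)
  have r2: "r * sqrt (2 * pi / l) = 1"
    using l by (simp add: r_def real_sqrt_mult[symmetric])
  have r3: "r * sqrt (12 * pi / l) \<le> 5/2"
  proof -
    have "r * sqrt (12 * pi / l) = sqrt 6"
      using l by (simp add: r_def real_sqrt_mult[symmetric])
    also have "sqrt 6 \<le> sqrt ((5/2)^2)"
      by (intro real_sqrt_le_mono) (simp add: power2_eq_square)
    finally show ?thesis by simp
  qed
  have "r * (2 * pi * pmf (poisson_walk l) k - sqrt (2 * pi / l) * exp (- ((real_of_int k)^2) / (2 * l))) =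
      r * (2 * pi) * pmf (poisson_walk l) k - r * sqrt (2 * pi / l) * exp (- ((real_of_int k)^2) / (2 * l))"
    by (simp only: right_diff_distrib mult.assoc)
  then have "\<bar>r * (2 * pi * pmf (poisson_walk l) k - sqrt (2 * pi / l) * exp (- ((real_of_int k)^2) / (2 * l)))\<bar>
      = \<bar>sqrt (2 * pi * l) * pmf (poisson_walk l) k - exp (- ((real_of_int k)^2 / (2 * l)))\<bar>"
    by (simp only: r1 r2 minus_divide_left mult_1_left)
  then have "\<bar>sqrt (2 * pi * l) * pmf (poisson_walk l) k - exp (- ((real_of_int k)^2 / (2 * l)))\<bar> =
     r * \<bar>2 * pi * pmf (poisson_walk l) k - sqrt (2 * pi / l) * exp (- ((real_of_int k)^2) / (2 * l))\<bar>"
    by (simp only: abs_mult abs_of_nonneg[OF r0])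
  also have "\<dots> \<le> r * (9/2 * sqrt (12 * pi / l) / l)"
    by (intro mult_left_mono main r0)
  also have "\<dots> = 9/2 * (r * sqrt (12 * pi / l)) / l"
    by simp
  also have "\<dots> \<le> 9/2 * (5/2) / l"
    using l r3 by (intro divide_right_mono mult_left_mono) auto
  also have "\<dots> \<le> 12 / l"
    using l by (intro divide_right_mono) auto
  finally show ?thesis .
qed

subsection \<open>Central limit theorem for the squared increments\<close>

text \<open>Half of this is the score of the Gaussian scale model: the derivative of
  \<open>- ln l / 2 - k^2 / (2 * l)\<close> with respect to \<open>ln l\<close>.\<close>

definition square_dev :: "real \<Rightarrow> int \<Rightarrow> real" where
  "square_dev l k = (real_of_int k)^2 / l - 1"

text \<open>The variance approaches the Gaussian value 2, and the third absolute moment is bounded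
  uniformly in \<open>l\<close>. This is a Lyapunov condition for the array whose entries change
  their law with \<open>T\<close>.\<close>

lemma poisson_walk_square_moments:
  assumes "l \<ge> 1"
  shows "has_bochner_integral (measure_pmf (poisson_walk l)) (square_dev l) 0"
    and "has_bochner_integral (measure_pmf (poisson_walk l)) (\<lambda>k. (square_dev l k)^2) (2 + 1 / l)"
    and "integrable (measure_pmf (poisson_walk l)) (\<lambda>k. \<bar>square_dev l k\<bar>^3)"
    and "measure_pmf.expectation (poisson_walk l) (\<lambda>k. \<bar>square_dev l k\<bar>^3) \<le> 128"
proof -
  let ?M = "measure_pmf (poisson_walk l)"
  have l: "l > 0" using assms(1) by simp
  have one: "has_bochner_integral ?M (\<lambda>_. 1 :: real) 1"
    by (simp add: has_bochner_integral_iff)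
  note m2 = poisson_walk_moment2[OF l] and m4 = poisson_walk_moment4[OF l] and m6 = poisson_walk_moment6[OF l]
  have "has_bochner_integral ?M (square_dev l) (l / l - 1)"
    unfolding square_dev_def by (intro has_bochner_integral_diff has_bochner_integral_divide_zero m2 one)
  then show "has_bochner_integral ?M (square_dev l) 0"
    using l by simp
  have "has_bochner_integral ?M (\<lambda>k. (real_of_int k)^4 / l^2 - 2 / l * (real_of_int k)^2 + 1) ((3 * l^2 + l) / l^2 - 2 / l * l + 1)"
    by (intro has_bochner_integral_add has_bochner_integral_diff has_bochner_integral_divide_zero
          has_bochner_integral_mult_right m2 m4 one)
  also have "(\<lambda>k. (real_of_int k)^4 / l^2 - 2 / l * (real_of_int k)^2 + 1) = (\<lambda>k. (square_dev l k)^2)"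
    by (auto simp: fun_eq_iff square_dev_def power2_eq_square power4_eq_xxxx algebra_simps)
  also have "(3 * l^2 + l) / l^2 - 2 / l * l + 1 = 2 + 1 / l"
    using l by (simp add: power2_eq_square field_simps)
  finally show "has_bochner_integral ?M (\<lambda>k. (square_dev l k)^2) (2 + 1 / l)" .
  let ?B = "\<lambda>k. 4 * ((real_of_int k)^6 / l^3 + 1)"
  have B: "has_bochner_integral ?M ?B (4 * ((15 * l^3 + 15 * l^2 + l) / l^3 + 1))"
    by (intro has_bochner_integral_add has_bochner_integral_divide_zero has_bochner_integral_mult_right m6 one)
  have bd: "\<bar>square_dev l k\<bar>^3 \<le> ?B k" for k
  proof -
    define y where "y = (real_of_int k)^2 / l"
    have y: "y \<ge> 0" using l by (simp add: y_def)
    have "\<bar>square_dev l k\<bar> \<le> y + 1"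
      using y by (auto simp: square_dev_def y_def[symmetric])
    then have "\<bar>square_dev l k\<bar>^3 \<le> (y + 1)^3"
      by (intro power_mono) auto
    \<comment> \<open>Convexity of the cube in explicit form: it reduces the third absolute moment
      to the sixth moment of the walk.\<close>
    also have "(y + 1)^3 = 4 * (y^3 + 1) - 3 * ((y + 1) * (y - 1)^2)"
      by (simp add: power3_eq_cube power2_eq_square algebra_simps)
    also have "\<dots> \<le> 4 * (y^3 + 1)"
      using y by simp
    also have "y^3 = (real_of_int k)^6 / l^3"
      by (simp add: y_def power_divide power_mult[symmetric])
    finally show ?thesis .
  qed
  show int3: "integrable ?M (\<lambda>k. \<bar>square_dev l k\<bar>^3)"
  proof (rule Bochner_Integration.integrable_bound)
    show "integrable ?M ?B" using B by (simp only: has_bochner_integral_iff)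
    show "AE k in ?M. norm (\<bar>square_dev l k\<bar>^3) \<le> norm (?B k)"
    proof (rule AE_I2)
      fix k
      have "norm (\<bar>square_dev l k\<bar>^3) = \<bar>square_dev l k\<bar>^3" by simp
      also note bd[of k]
      also have "?B k \<le> norm (?B k)" by simp
      finally show "norm (\<bar>square_dev l k\<bar>^3) \<le> norm (?B k)" .
    qed
  qed simp
  have "integral\<^sup>L ?M (\<lambda>k. \<bar>square_dev l k\<bar>^3) \<le> integral\<^sup>L ?M ?B"
    using B by (intro integral_mono int3 bd) (simp only: has_bochner_integral_iff)
  also have "\<dots> = 4 * ((15 * l^3 + 15 * l^2 + l) / l^3 + 1)"
    using B by (simp only: has_bochner_integral_iff)
  also have "\<dots> \<le> 4 * (31 + 1)"
  proof -
    have "l^2 \<le> l^3" "l^1 \<le> l^3"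
      using assms(1) by (intro power_increasing; simp)+
    then have "15 * l^3 + 15 * l^2 + l \<le> 31 * l^3" by simp
    then show ?thesis
      using l by (simp add: divide_le_eq)
  qed
  finally show "integral\<^sup>L ?M (\<lambda>k. \<bar>square_dev l k\<bar>^3) \<le> 128" by simp
qed

text \<open>Second order expansion of the characteristic function. Bounding the minimum in its
  remainder by the cubic entry gives the constant 128/6 < 22, the same for all
  \<open>l\<close>.\<close>

lemma char_poisson_walk_square:
  assumes "l \<ge> 1"
  shows "cmod (char (distr (measure_pmf (poisson_walk l)) borel (square_dev l)) u - (1 - u^2 * (2 + 1 / l) / 2)) \<le> 22 * \<bar>u\<bar>^3"
proof -
  let ?M = "measure_pmf (poisson_walk l)"
  note mom = poisson_walk_square_moments[OF assms(1)]
  have "cmod (char (distr ?M borel (square_dev l)) u - (1 - u^2 * (2 + 1 / l) / 2)) \<le>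
     u^2 / 6 * measure_pmf.expectation (poisson_walk l) (\<lambda>k. min (6 * (square_dev l k)^2) (\<bar>u\<bar> * \<bar>square_dev l k\<bar>^3))"
  proof -
    have E0: "measure_pmf.expectation (poisson_walk l) (square_dev l) = 0"
      using mom(1) by (simp only: has_bochner_integral_iff)
    have V: "measure_pmf.variance (poisson_walk l) (square_dev l) = 2 + 1 / l"
      unfolding E0 using mom(2) by (simp add: has_bochner_integral_iff)
    show ?thesis
      using mom(1,2) by (intro prob_space.char_approx3'[OF measure_pmf.prob_space_axioms] E0 V) (auto simp: has_bochner_integral_iff)
  qed
  also have "measure_pmf.expectation (poisson_walk l) (\<lambda>k. min (6 * (square_dev l k)^2) (\<bar>u\<bar> * \<bar>square_dev l k\<bar>^3)) \<le>
     measure_pmf.expectation (poisson_walk l) (\<lambda>k. \<bar>u\<bar> * \<bar>square_dev l k\<bar>^3)"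
  proof (rule integral_mono)
    show "integrable ?M (\<lambda>k. min (6 * (square_dev l k)^2) (\<bar>u\<bar> * \<bar>square_dev l k\<bar>^3))"
      using mom(2,3) by (intro integrable_min) (auto simp: has_bochner_integral_iff)
  qed (use mom(3) in auto)
  also have "\<dots> \<le> \<bar>u\<bar> * 128"
    using mom(4) by (simp add: mult_left_mono)
  finally have "cmod (char (distr ?M borel (square_dev l)) u - (1 - u^2 * (2 + 1 / l) / 2)) \<le> u^2 / 6 * (\<bar>u\<bar> * 128)"
    by (simp add: mult_left_mono)
  also have "\<dots> = 128 / 6 * \<bar>u\<bar>^3"
    by (simp add: power3_eq_cube power2_eq_square)
  also have "\<dots> \<le> 22 * \<bar>u\<bar>^3"
    by (intro mult_right_mono) auto
  finally show ?thesis .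
qed

lemma expectation_bind_bounded:
  fixes f :: "'b \<Rightarrow> real"
  assumes "\<And>x. \<bar>f x\<bar> \<le> B"
  shows "measure_pmf.expectation (bind_pmf p N) f = measure_pmf.expectation p (\<lambda>x. measure_pmf.expectation (N x) f)"
  unfolding measure_pmf_bind
proof (rule integral_bind[where K = "count_space UNIV" and B = B and B' = 1])
  show "(\<lambda>x. measure_pmf (N x)) \<in> measurable (measure_pmf p) (subprob_algebra (count_space UNIV))"
    using measurable_measure_pmf[of N] by simp
qed (use assms in \<open>auto intro: measure_pmf.finite_measure_axioms\<close>)

lemma expectation_replicate_pmf_Suc:
  fixes f :: "'a list \<Rightarrow> real"
  assumes "\<And>x. \<bar>f x\<bar> \<le> B"
  shows "measure_pmf.expectation (replicate_pmf (Suc n) p) f =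
    measure_pmf.expectation p (\<lambda>x. measure_pmf.expectation (replicate_pmf n p) (\<lambda>xs. f (x # xs)))"
  using assms by (simp add: expectation_bind_bounded[where B = B])

text \<open>Splitting into real and imaginary parts makes the recursion
  \<open>expectation_replicate_pmf_Suc\<close>, stated for bounded real functions, applicable to
  characteristic functions.\<close>

lemma char_pmf:
  fixes f :: "'a \<Rightarrow> real"
  shows "char (distr (measure_pmf p) borel f) t =
    Complex (measure_pmf.expectation p (\<lambda>x. cos (t * f x))) (measure_pmf.expectation p (\<lambda>x. sin (t * f x)))"
proof -
  have int: "integrable (measure_pmf p) (\<lambda>x. iexp (t * f x))"
    by (intro prob_space.integrable_iexp[OF measure_pmf.prob_space_axioms]) auto
  have "char (distr (measure_pmf p) borel f) t = (CLINT x|measure_pmf p. iexp (t * f x))"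
    unfolding char_def by (subst integral_distr) auto
  also have "\<dots> = Complex (measure_pmf.expectation p (\<lambda>x. cos (t * f x))) (measure_pmf.expectation p (\<lambda>x. sin (t * f x)))"
    using integral_Re[OF int] integral_Im[OF int] by (intro complex_eqI) (simp_all add: Re_exp Im_exp)
  finally show ?thesis .
qed

lemma integrable_pmf_trig [simp]:
  fixes f :: "'a \<Rightarrow> real"
  shows "integrable (measure_pmf p) (\<lambda>x. cos (f x))" "integrable (measure_pmf p) (\<lambda>x. sin (f x))"
  by (auto intro!: measure_pmf.integrable_const_bound[where B = 1])

text \<open>By independence, with the addition theorems for cosine and sine playing the role of
  complex multiplication.\<close>

lemma char_sum_replicate_pmf:
  fixes f :: "'a \<Rightarrow> real"
  shows "char (distr (measure_pmf (replicate_pmf n p)) borel (\<lambda>xs. \<Sum>x\<leftarrow>xs. f x)) t = char (distr (measure_pmf p) borel f) t ^ n"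
proof (induction n)
  case 0
  then show ?case
    by (simp add: char_pmf complex_eq_iff)
next
  case (Suc n)
  let ?S = "\<lambda>xs. \<Sum>x\<leftarrow>xs. f x"
  let ?C = "measure_pmf.expectation (replicate_pmf n p) (\<lambda>xs. cos (t * ?S xs))"
  let ?D = "measure_pmf.expectation (replicate_pmf n p) (\<lambda>xs. sin (t * ?S xs))"
  have 1: "measure_pmf.expectation (replicate_pmf (Suc n) p) (\<lambda>xs. cos (t * ?S xs)) =
      measure_pmf.expectation p (\<lambda>x. cos (t * f x)) * ?C - measure_pmf.expectation p (\<lambda>x. sin (t * f x)) * ?D"
    by (subst expectation_replicate_pmf_Suc[where B = 1]) (auto simp: distrib_left cos_add)
  have 2: "measure_pmf.expectation (replicate_pmf (Suc n) p) (\<lambda>xs. sin (t * ?S xs)) =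
      measure_pmf.expectation p (\<lambda>x. sin (t * f x)) * ?C + measure_pmf.expectation p (\<lambda>x. cos (t * f x)) * ?D"
    by (subst expectation_replicate_pmf_Suc[where B = 1]) (auto simp: distrib_left sin_add)
  show ?case
    unfolding power_Suc unfolding Suc.IH[symmetric] unfolding char_pmf 1 2 by (simp add: complex_eq_iff)
qed

lemma char_divide:
  fixes f :: "'a \<Rightarrow> real"
  shows "char (distr (measure_pmf p) borel (\<lambda>x. f x / c)) t = char (distr (measure_pmf p) borel f) (t / c)"
  by (simp add: char_pmf)

text \<open>The union bound, by induction through conditioning on the first entry.\<close>

lemma prob_replicate_pmf_ex:
  "measure_pmf.prob (replicate_pmf n p) {xs. \<exists>x\<in>set xs. x \<in> A} \<le> real n * measure_pmf.prob p A"
proof (induction n)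
  case 0
  then show ?case by simp
next
  case (Suc n)
  let ?ind = "indicator {xs. \<exists>x\<in>set xs. x \<in> A} :: 'a list \<Rightarrow> real"
  have int: "integrable (measure_pmf q) (indicator B :: 'c \<Rightarrow> real)" for q and B :: "'c set"
    by (intro measure_pmf.integrable_const_bound[where B = 1]) auto
  have "measure_pmf.prob (replicate_pmf (Suc n) p) {xs. \<exists>x\<in>set xs. x \<in> A} = measure_pmf.expectation (replicate_pmf (Suc n) p) ?ind"
    by simp
  also have "\<dots> = measure_pmf.expectation p (\<lambda>x. measure_pmf.expectation (replicate_pmf n p) (\<lambda>xs. ?ind (x # xs)))"
    by (rule expectation_replicate_pmf_Suc[where B = 1]) auto
  also have "\<dots> \<le> measure_pmf.expectation p (\<lambda>x. indicator A x + measure_pmf.prob (replicate_pmf n p) {xs. \<exists>x\<in>set xs. x \<in> A})"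
  proof (rule integral_mono)
    fix x
    have "measure_pmf.expectation (replicate_pmf n p) (\<lambda>xs. ?ind (x # xs)) \<le>
       measure_pmf.expectation (replicate_pmf n p) (\<lambda>xs. indicator A x + ?ind xs)"
      by (intro integral_mono Bochner_Integration.integrable_add int integrable_const
            measure_pmf.integrable_const_bound[where B = 1]) (auto simp: indicator_def)
    also have "\<dots> = indicator A x + measure_pmf.prob (replicate_pmf n p) {xs. \<exists>x\<in>set xs. x \<in> A}"
      using int by (subst Bochner_Integration.integral_add) auto
    finally show "measure_pmf.expectation (replicate_pmf n p) (\<lambda>xs. ?ind (x # xs)) \<le> \<dots>" .
  next
    show "integrable (measure_pmf p) (\<lambda>x. measure_pmf.expectation (replicate_pmf n p) (\<lambda>xs. ?ind (x # xs)))"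
    proof (rule measure_pmf.integrable_const_bound[where B = 1])
      have "norm (measure_pmf.expectation (replicate_pmf n p) (\<lambda>xs. ?ind (x # xs))) \<le> 1" for x
      proof -
        have *: "(\<lambda>xs. ?ind (x # xs)) = indicator {xs. \<exists>y\<in>set (x # xs). y \<in> A}"
          by (auto simp: fun_eq_iff indicator_def)
        show ?thesis
          unfolding * by (simp del: list.set)
      qed
      then show "AE x in measure_pmf p. norm (measure_pmf.expectation (replicate_pmf n p) (\<lambda>xs. ?ind (x # xs))) \<le> 1"
        by (rule AE_I2)
    qed simp
  next
    show "integrable (measure_pmf p) (\<lambda>x. indicator A x + measure_pmf.prob (replicate_pmf n p) {xs. \<exists>x\<in>set xs. x \<in> A})"
      by (intro Bochner_Integration.integrable_add int) simp
  qed
  also have "\<dots> = measure_pmf.prob p A + measure_pmf.prob (replicate_pmf n p) {xs. \<exists>x\<in>set xs. x \<in> A}"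
    using int by (subst Bochner_Integration.integral_add) auto
  also have "\<dots> \<le> real (Suc n) * measure_pmf.prob p A"
    using Suc.IH by (simp add: algebra_simps)
  finally show ?case .
qed

text \<open>Levy's continuity theorem concerns sequences; a limit along real \<open>T\<close>
  follows by applying it to every sequence \<open>X\<close> that tends to infinity.\<close>

lemma conv_in_distr_charI:
  fixes P :: "real \<Rightarrow> 'a pmf" and \<xi> :: "real \<Rightarrow> 'a \<Rightarrow> real"
  assumes "real_distribution \<mu>"
    and "\<And>t. ((\<lambda>T. char (distr (measure_pmf (P T)) borel (\<xi> T)) t) \<longlongrightarrow> char \<mu> t) at_top"
  shows "conv_in_distr at_top P \<xi> \<mu>"
  unfolding conv_in_distr_def
proof (intro allI impI)
  fix x assume x: "isCont (cdf \<mu>) x"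
  show "((\<lambda>T. measure_pmf.prob (P T) {\<omega>. \<xi> T \<omega> \<le> x}) \<longlongrightarrow> cdf \<mu> x) at_top"
  proof (rule tendsto_at_topI_sequentially)
    fix X :: "nat \<Rightarrow> real" assume X: "filterlim X at_top sequentially"
    let ?M = "\<lambda>j. distr (measure_pmf (P (X j))) borel (\<xi> (X j))"
    have "weak_conv_m ?M \<mu>"
    proof (rule levy_continuity)
      show "real_distribution (?M j)" for j
        by (intro prob_space.real_distribution_distr[OF measure_pmf.prob_space_axioms]) auto
      show "(\<lambda>j. char (?M j) t) \<longlonglongrightarrow> char \<mu> t" for t
        by (rule filterlim_compose[OF assms(2) X])
    qed fact
    then have "(\<lambda>j. cdf (?M j) x) \<longlonglongrightarrow> cdf \<mu> x"
      using x by (simp add: weak_conv_m_def weak_conv_def)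
    moreover have "cdf (?M j) x = measure_pmf.prob (P (X j)) {\<omega>. \<xi> (X j) \<omega> \<le> x}" for j
      unfolding cdf_def by (subst measure_distr) (auto intro!: arg_cong[where f = "measure _"])
    ultimately show "(\<lambda>j. measure_pmf.prob (P (X j)) {\<omega>. \<xi> (X j) \<omega> \<le> x}) \<longlonglongrightarrow> cdf \<mu> x"
      by simp
  qed
qed

text \<open>Transports a limit theorem from the increments to the observed path, from which
  \<open>inv g\<close> recovers the increments.\<close>

lemma conv_in_distr_map_inj:
  assumes "inj g" "conv_in_distr F P \<xi> \<mu>"
  shows "conv_in_distr F (\<lambda>T. map_pmf g (P T)) (\<lambda>T \<omega>. \<xi> T (inv g \<omega>)) \<mu>"
  using assms by (simp add: conv_in_distr_def vimage_def inv_f_f)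

text \<open>A case of Slutsky's theorem. Convergence in distribution gives tightness: eventually
  \<open>\<xi>\<close> leaves the interval from \<open>- K\<close> to \<open>K\<close> with
  probability below \<epsilon>/2, and inside it the product is at most \<epsilon> once
  \<open>\<bar>a T\<bar> < \<epsilon> / K\<close>.\<close>

lemma conv_in_distr_scaled_small:
  fixes a :: "real \<Rightarrow> real"
  assumes conv: "conv_in_distr at_top P \<xi> std_normal_distribution"
    and a: "(a \<longlongrightarrow> 0) at_top" and "\<epsilon> > 0"
  shows "\<forall>\<^sub>F T in at_top. measure_pmf.prob (P T) {\<omega>. \<bar>a T * \<xi> T \<omega>\<bar> > \<epsilon>} < \<epsilon>"
proof -
  interpret N: real_distribution std_normal_distribution
    by (rule real_dist_normal_dist)
  let ?F = "cdf std_normal_distribution"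
  \<comment> \<open>The normal law has no atoms, so the distribution functions converge at every
    point, in particular at \<open>K\<close> and \<open>- K\<close>.\<close>
  have cont: "isCont ?F x" for x
  proof -
    have "emeasure std_normal_distribution {x} = 0"
      by (subst emeasure_density) (auto intro: nn_integral_null_set)
    then show ?thesis
      by (simp add: N.isCont_cdf measure_def)
  qed
  have "\<forall>\<^sub>F x in at_top. ?F x > 1 - \<epsilon> / 4"
    using N.cdf_lim_at_top_prob \<open>\<epsilon> > 0\<close> by (intro order_tendstoD(1)) auto
  moreover have "\<forall>\<^sub>F x in at_top. ?F (- x) < \<epsilon> / 4"
    using filterlim_compose[OF N.cdf_lim_at_bot filterlim_uminus_at_bot_at_top] \<open>\<epsilon> > 0\<close> by (intro order_tendstoD(2)) auto
  moreover have "\<forall>\<^sub>F x in at_top. x > (0::real)"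
    by (rule eventually_gt_at_top)
  ultimately have "\<forall>\<^sub>F x in at_top. ?F x > 1 - \<epsilon> / 4 \<and> ?F (- x) < \<epsilon> / 4 \<and> x > 0"
    by eventually_elim auto
  then obtain K where K: "?F K > 1 - \<epsilon> / 4" "?F (- K) < \<epsilon> / 4" "K > 0"
    by (auto dest!: eventually_happens)
  have lim: "((\<lambda>T. measure_pmf.prob (P T) {\<omega>. \<xi> T \<omega> \<le> x}) \<longlongrightarrow> ?F x) at_top" for x
    using conv cont by (auto simp: conv_in_distr_def)
  have "\<forall>\<^sub>F T in at_top. \<bar>a T\<bar> < \<epsilon> / K"
    using tendsto_rabs[OF a] \<open>\<epsilon> > 0\<close> K by (intro order_tendstoD(2)) auto
  moreover have "\<forall>\<^sub>F T in at_top. measure_pmf.prob (P T) {\<omega>. \<xi> T \<omega> \<le> K} > 1 - \<epsilon> / 4"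
    using lim K(1) by (rule order_tendstoD(1))
  moreover have "\<forall>\<^sub>F T in at_top. measure_pmf.prob (P T) {\<omega>. \<xi> T \<omega> \<le> - K} < \<epsilon> / 4"
    using lim K(2) by (rule order_tendstoD(2))
  ultimately show ?thesis
  proof eventually_elim
    case (elim T)
    have "{\<omega>. \<bar>a T * \<xi> T \<omega>\<bar> > \<epsilon>} \<subseteq> (UNIV - {\<omega>. \<xi> T \<omega> \<le> K}) \<union> {\<omega>. \<xi> T \<omega> \<le> - K}"
    proof (rule subsetI, rule ccontr)
      fix \<omega> assume "\<omega> \<in> {\<omega>. \<bar>a T * \<xi> T \<omega>\<bar> > \<epsilon>}"
        "\<omega> \<notin> (UNIV - {\<omega>. \<xi> T \<omega> \<le> K}) \<union> {\<omega>. \<xi> T \<omega> \<le> - K}"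
      then have *: "\<bar>a T * \<xi> T \<omega>\<bar> > \<epsilon>" "\<not> \<xi> T \<omega> \<le> - K" "\<xi> T \<omega> \<le> K"
        by simp_all
      then have "\<bar>\<xi> T \<omega>\<bar> \<le> K" by auto
      then have "\<bar>a T * \<xi> T \<omega>\<bar> \<le> \<epsilon> / K * K"
        unfolding abs_mult using elim(1) \<open>\<epsilon> > 0\<close> K by (intro mult_mono) auto
      with * K show False by simp
    qed
    then have "measure_pmf.prob (P T) {\<omega>. \<bar>a T * \<xi> T \<omega>\<bar> > \<epsilon>} \<le>
       measure_pmf.prob (P T) ((UNIV - {\<omega>. \<xi> T \<omega> \<le> K}) \<union> {\<omega>. \<xi> T \<omega> \<le> - K})"
      by (intro measure_pmf.finite_measure_mono) auto
    also have "\<dots> \<le> measure_pmf.prob (P T) (UNIV - {\<omega>. \<xi> T \<omega> \<le> K}) + measure_pmf.prob (P T) {\<omega>. \<xi> T \<omega> \<le> - K}"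
      by (intro measure_Un_le) auto
    also have "measure_pmf.prob (P T) (UNIV - {\<omega>. \<xi> T \<omega> \<le> K}) = 1 - measure_pmf.prob (P T) {\<omega>. \<xi> T \<omega> \<le> K}"
      using measure_pmf.prob_compl[of "{\<omega>. \<xi> T \<omega> \<le> K}" "P T"] by simp
    finally show ?case
      using elim(2,3) \<open>\<epsilon> > 0\<close> by simp
  qed
qed

text \<open>The characteristic function of the sum is compared with the \<open>n\<close>-th power of
  a real exponential. The error is at most \<open>n\<close> times a quantity of order
  \<open>\<bar>u\<bar>^3\<close>, which vanishes because \<open>m * u^2\<close> is constant and
  \<open>u\<close> tends to 0.\<close>

lemma poisson_walk_clt:
  fixes l m :: "real \<Rightarrow> real" and n :: "real \<Rightarrow> nat"
  assumes l: "filterlim l at_top at_top" and m: "filterlim m at_top at_top"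
    and nm: "\<forall>\<^sub>F T in at_top. real (n T) \<le> m T" and lim: "((\<lambda>T. real (n T) / m T) \<longlongrightarrow> 1) at_top"
  shows "conv_in_distr at_top (\<lambda>T. replicate_pmf (n T) (poisson_walk (l T)))
     (\<lambda>T xs. (\<Sum>k\<leftarrow>xs. square_dev (l T) k) / sqrt (2 * m T)) std_normal_distribution"
proof (rule conv_in_distr_charI[OF real_dist_normal_dist])
  fix t :: real
  define u where "u T = t / sqrt (2 * m T)" for T
  define z where "z T = char (distr (measure_pmf (poisson_walk (l T))) borel (square_dev (l T))) (u T)" for T
  \<comment> \<open>Half the variance of one entry at frequency \<open>u T\<close>;
    \<open>n T * x T\<close> tends to \<open>t^2 / 2\<close>, the Gaussian exponent.\<close>
  define x where "x T = (u T)^2 * (2 + 1 / l T) / 2" for T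
  have char_eq: "char (distr (measure_pmf (replicate_pmf (n T) (poisson_walk (l T)))) borel
      (\<lambda>xs. (\<Sum>k\<leftarrow>xs. square_dev (l T) k) / sqrt (2 * m T))) t = z T ^ n T" for T
    unfolding char_divide char_sum_replicate_pmf z_def u_def ..
  have ev: "\<forall>\<^sub>F T in at_top. l T \<ge> 1 \<and> m T > 0 \<and> real (n T) \<le> m T"
    using filterlim_at_top_dense[THEN iffD1, OF m, rule_format, of 0] 
      filterlim_at_top[THEN iffD1, OF l, rule_format, of 1] nm by eventually_elim auto
  have u2: "m T * (u T)^2 = t^2 / 2" if "m T > 0" for T
    using that by (simp add: u_def power_divide)
  have diff_bound: "\<forall>\<^sub>F T in at_top. norm (z T ^ n T - complex_of_real (exp (- (x T))) ^ n T) \<le> t^2 / 2 * (22 * \<bar>u T\<bar> + 3 * (u T)^2)"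
    using ev
  proof eventually_elim
    case (elim T)
    interpret D: real_distribution "distr (measure_pmf (poisson_walk (l T))) borel (square_dev (l T))"
      by (intro prob_space.real_distribution_distr[OF measure_pmf.prob_space_axioms]) auto
    have x: "0 \<le> x T" "x T \<le> 3/2 * (u T)^2"
    proof -
      show "0 \<le> x T" using elim by (auto simp: x_def intro!: mult_nonneg_nonneg)
      have "(u T)^2 * (2 + 1 / l T) \<le> (u T)^2 * 3"
        using elim by (intro mult_left_mono) (auto simp: field_simps)
      then show "x T \<le> 3/2 * (u T)^2" by (simp add: x_def)
    qed
    have e: "\<bar>1 - x T - exp (- (x T))\<bar> \<le> 3 * (u T)^4"
    proof -
      have "exp (- (x T)) * (1 + x T) \<le> exp (- (x T)) * exp (x T)"
        by (intro mult_left_mono exp_ge_add_one_self) auto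
      then have "exp (- (x T)) * (1 + x T) \<le> 1"
        by (simp add: exp_add[symmetric])
      moreover have "exp (- (x T)) * x T \<ge> (1 - x T) * x T"
        using x by (intro mult_right_mono exp_minus_ge) auto
      ultimately have "exp (- (x T)) \<le> 1 - x T + (x T)^2"
        by (simp add: algebra_simps power2_eq_square)
      moreover have "exp (- (x T)) \<ge> 1 - x T"
        by (rule exp_minus_ge)
      moreover have "(x T)^2 \<le> (3/2 * (u T)^2)^2"
        using x by (intro power_mono) auto
      moreover have "(3/2 * (u T)^2)^2 \<le> 3 * (u T)^4"
        by (simp add: power_mult_distrib power_mult[symmetric] power_divide)
      ultimately show ?thesis by linarith
    qed
    have "norm (z T - complex_of_real (exp (- (x T)))) \<le>
        cmod (z T - (1 - (u T)^2 * (2 + 1 / l T) / 2)) + cmod (complex_of_real (1 - x T) - complex_of_real (exp (- (x T))))"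
      using norm_triangle_ineq[of "z T - (1 - (u T)^2 * (2 + 1 / l T) / 2)" "complex_of_real (1 - x T) - complex_of_real (exp (- (x T)))"]
      by (simp add: x_def)
    also have "cmod (z T - (1 - (u T)^2 * (2 + 1 / l T) / 2)) \<le> 22 * \<bar>u T\<bar>^3"
      using char_poisson_walk_square[of "l T" "u T"] elim unfolding z_def by simp
    also have "cmod (complex_of_real (1 - x T) - complex_of_real (exp (- (x T)))) \<le> 3 * (u T)^4"
      using e by (simp only: of_real_diff[symmetric] norm_of_real)
    finally have zw: "norm (z T - complex_of_real (exp (- (x T)))) \<le> 22 * \<bar>u T\<bar>^3 + 3 * (u T)^4"
      by simp
    \<comment> \<open>Both bases lie in the unit disc, one as a characteristic function and the
      other because \<open>x T\<close> is nonnegative. Powers then differ by at most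
      \<open>n\<close> times the difference of the bases.\<close>
    have "norm (z T ^ n T - complex_of_real (exp (- (x T))) ^ n T) \<le> real (n T) * norm (z T - complex_of_real (exp (- (x T))))"
      using x by (intro norm_power_diff) (auto simp: z_def D.cmod_char_le_1)
    also have "\<dots> \<le> m T * (22 * \<bar>u T\<bar>^3 + 3 * (u T)^4)"
      using elim zw by (intro mult_mono) auto
    also have "\<dots> = (m T * (u T)^2) * (22 * \<bar>u T\<bar> + 3 * (u T)^2)"
    proof -
      have "\<bar>u T\<bar>^3 = (u T)^2 * \<bar>u T\<bar>" "(u T)^4 = (u T)^2 * (u T)^2"
        by (simp_all add: power3_eq_cube power2_eq_square power4_eq_xxxx)
      then show ?thesis by (simp only: distrib_left mult_ac)
    qed
    also have "\<dots> = t^2 / 2 * (22 * \<bar>u T\<bar> + 3 * (u T)^2)"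
      unfolding u2[OF conjunct1[OF conjunct2[OF elim]]] ..
    finally show ?case .
  qed
  have u0: "(u \<longlongrightarrow> 0) at_top"
  proof -
    have "filterlim (\<lambda>T. 2 * m T) at_top at_top"
      by (rule filterlim_tendsto_pos_mult_at_top[OF tendsto_const _ m]) simp
    from filterlim_compose[OF sqrt_at_top this] show ?thesis
      unfolding u_def by (rule tendsto_divide_0[OF tendsto_const filterlim_at_top_imp_at_infinity])
  qed
  have "isCont (\<lambda>y. t^2 / 2 * (22 * \<bar>y\<bar> + 3 * y^2)) 0"
    by (intro continuous_intros)
  from isCont_tendsto_compose[OF this u0]
  have "((\<lambda>T. t^2 / 2 * (22 * \<bar>u T\<bar> + 3 * (u T)^2)) \<longlongrightarrow> 0) at_top"
    by simp
  with diff_bound have d0: "((\<lambda>T. z T ^ n T - complex_of_real (exp (- (x T))) ^ n T) \<longlongrightarrow> 0) at_top"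
    by (rule Lim_null_comparison)
  have l0: "((\<lambda>T. 1 / l T) \<longlongrightarrow> 0) at_top"
    by (rule tendsto_divide_0[OF tendsto_const filterlim_at_top_imp_at_infinity[OF l]])
  have "((\<lambda>T. complex_of_real (exp (- (real (n T) / m T * (t^2 / 2 * (2 + 1 / l T) / 2))))) \<longlongrightarrow>
     complex_of_real (exp (- (1 * (t^2 / 2 * (2 + 0) / 2))))) at_top"
    by (intro tendsto_intros lim l0) simp_all
  moreover have "\<forall>\<^sub>F T in at_top. complex_of_real (exp (- (real (n T) / m T * (t^2 / 2 * (2 + 1 / l T) / 2)))) =
     complex_of_real (exp (- (x T))) ^ n T"
    using ev
  proof eventually_elim
    case (elim T)
    have "real (n T) / m T * (t^2 / 2 * (2 + 1 / l T) / 2) = real (n T) * x T"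
      using elim unfolding u2[of T, symmetric, OF conjunct1[OF conjunct2[OF elim]]] x_def by simp
    then show ?case
      by (simp only: of_real_power[symmetric] exp_of_nat_mult[symmetric] mult_minus_right)
  qed
  ultimately have "((\<lambda>T. complex_of_real (exp (- (x T))) ^ n T) \<longlongrightarrow> complex_of_real (exp (- (1 * (t^2 / 2 * (2 + 0) / 2))))) at_top"
    by (rule Lim_transform_eventually)
  from tendsto_add[OF d0 this]
  show "((\<lambda>T. char (distr (measure_pmf (replicate_pmf (n T) (poisson_walk (l T)))) borel
      (\<lambda>xs. (\<Sum>k\<leftarrow>xs. square_dev (l T) k) / sqrt (2 * m T))) t) \<longlongrightarrow> char std_normal_distribution t) at_top"
    unfolding char_eq by (simp add: char_std_normal_distribution)
qed

subsection \<open>The log-likelihood ratio\<close>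

lemma partial_sums_neq_Nil [simp]: "partial_sums s xs \<noteq> []" "[] \<noteq> partial_sums s xs"
  by (cases xs; simp)+

lemma hd_partial_sums [simp]: "hd (partial_sums s xs) = s"
  by (cases xs) auto

text \<open>The increments can be read off the path, so path and increments have the same likelihood
  ratios.\<close>

lemma partial_sums_inject: "partial_sums s xs = partial_sums s ys \<Longrightarrow> xs = ys"
proof (induction xs arbitrary: s ys)
  case Nil
  then show ?case
    by (cases ys) auto
next
  case (Cons x xs)
  then obtain y ys' where ys: "ys = y # ys'"
    by (cases ys) auto
  with Cons.prems have eq: "partial_sums (s + x) xs = partial_sums (s + y) ys'"
    by simp
  from arg_cong[OF this, of hd] have "x = y"
    by simp
  with eq Cons.IH ys show ?case
    by auto
qed

lemma pmf_replicate_pmf: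
  "length xs = n \<Longrightarrow> pmf (replicate_pmf n p) xs = (\<Prod>x\<leftarrow>xs. pmf p x)"
proof (induction n arbitrary: xs)
  case (Suc n)
  then obtain y ys where xs: "xs = y # ys" "length ys = n"
    by (cases xs) auto
  have "replicate_pmf (Suc n) p = map_pmf (\<lambda>(x, xs). x # xs) (pair_pmf p (replicate_pmf n p))"
    by (simp add: pair_pmf_def map_bind_pmf)
  moreover have "inj (\<lambda>(x, xs). x # xs)"
    by (auto simp: inj_def)
  ultimately have "pmf (replicate_pmf (Suc n) p) xs = pmf (pair_pmf p (replicate_pmf n p)) (y, ys)"
    using pmf_map_inj'[of "\<lambda>(x, xs). x # xs" "pair_pmf p (replicate_pmf n p)" "(y, ys)"] by (simp add: xs)
  then show ?case
    using Suc.IH[of ys] xs by (simp add: pmf_pair)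
qed simp

text \<open>Dividing the local limit error \<open>12 / l\<close> by the Gaussian weight gives a
  relative error \<open>y\<close> of at most \<open>12 * exp (k^2 / (2 * l)) / l\<close>. The
  hypothesis keeps it below 1/2, where the weight is positive and \<open>ln (1 + y)\<close> is at
  most twice \<open>y\<close> in absolute value.\<close>

lemma ln_pmf_poisson_walk:
  assumes "l \<ge> 1" and le: "24 * exp ((real_of_int k)^2 / (2 * l)) \<le> l"
  shows "pmf (poisson_walk l) k > 0"
    and "\<bar>ln (pmf (poisson_walk l) k) - (- ln (2 * pi * l) / 2 - (real_of_int k)^2 / (2 * l))\<bar>
      \<le> 24 * exp ((real_of_int k)^2 / (2 * l)) / l"
proof -
  define r where "r = (real_of_int k)^2 / (2 * l)"
  define p where "p = pmf (poisson_walk l) k"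
  define s where "s = sqrt (2 * pi * l)"
  define y where "y = s * p * exp r - 1"
  have l: "l > 0" using assms by simp
  have s: "s > 0" using l by (simp add: s_def)
  have "\<bar>s * p - exp (- r)\<bar> * exp r \<le> 12 / l * exp r"
    using poisson_walk_local_limit[OF assms(1), of k] by (intro mult_right_mono) (auto simp: s_def p_def r_def)
  moreover have "\<bar>s * p - exp (- r)\<bar> * exp r = \<bar>(s * p - exp (- r)) * exp r\<bar>"
    by (simp add: abs_mult)
  moreover have "(s * p - exp (- r)) * exp r = y"
    by (simp add: y_def left_diff_distrib exp_add[symmetric])
  ultimately have y: "\<bar>y\<bar> \<le> 12 * exp r / l"
    by simp
  also have "\<dots> \<le> 1/2"
    using le l by (simp add: r_def divide_le_eq)
  finally have y2: "\<bar>y\<bar> \<le> 1/2" .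
  then have y1: "1 + y > 0"
    by linarith
  have p_eq: "p = (1 + y) / (s * exp r)"
    using s by (simp add: y_def)
  then show pos: "pmf (poisson_walk l) k > 0"
    using y1 s by (simp add: p_def[symmetric])
  have "ln p = ln (1 + y) - (ln s + r)"
    unfolding p_eq using y1 s by (simp add: ln_div ln_mult)
  moreover have "ln s = ln (2 * pi * l) / 2"
    using l by (simp add: s_def ln_sqrt)
  ultimately have "ln p - (- ln (2 * pi * l) / 2 - r) = ln (1 + y)"
    by simp
  moreover have "\<bar>ln (1 + y)\<bar> \<le> 2 * \<bar>y\<bar>"
  proof -
    have "2 * y^2 \<le> \<bar>y\<bar>"
      using mult_right_mono[OF y2, of "\<bar>y\<bar>"] by (simp add: power2_eq_square)
    with abs_ln_one_plus_x_minus_x_bound[OF y2] show ?thesis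
      by linarith
  qed
  ultimately show "\<bar>ln (pmf (poisson_walk l) k) - (- ln (2 * pi * l) / 2 - (real_of_int k)^2 / (2 * l))\<bar>
      \<le> 24 * exp ((real_of_int k)^2 / (2 * l)) / l"
    using y unfolding p_def[symmetric] r_def[symmetric] by simp
qed

text \<open>The range \<open>k^2 \<le> 5 l ln m\<close> is wide enough for about \<open>m\<close> tail probabilities of order
  \<open>m powr (-5/4)\<close> to be negligible, and narrow enough for the Gaussian weight to lose at most
  a factor \<open>m^3\<close> at both parameters.\<close>
lemma ln_pmf_ratio_poisson_walk:
  fixes l m h :: real
  assumes m: "m \<ge> 1" and l: "36 * m^3 \<le> l" and h: "\<bar>h\<bar> \<le> 1/6"
    and k: "(real_of_int k)^2 \<le> 5 * l * ln m"
  shows "pmf (poisson_walk l) k > 0" "pmf (poisson_walk (l * (1 + h))) k > 0"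
    and "\<bar>ln (pmf (poisson_walk (l * (1 + h))) k) - ln (pmf (poisson_walk l) k)
       - (- ln (1 + h) / 2 + (real_of_int k)^2 / (2 * l) * (h / (1 + h)))\<bar> \<le> 60 * m^3 / l"
proof -
  define l' where "l' = l * (1 + h)"
  have "m^3 \<ge> 1" using m by simp
  with l have l36: "l \<ge> 36" by simp
  \<comment> \<open>The exponent at the perturbed parameter is thus at most 6/5 * 5/2 *
    \<open>ln m\<close> = 3 \<open>ln m\<close>, the source of \<open>m^3\<close>. Since 36 * 5/6 =
    30 exceeds 24, the relative error is admissible at both parameters.\<close>
  have h1: "1 + h \<ge> 5/6" using h by linarith
  have l'l: "l' \<ge> 5/6 * l"
    using mult_left_mono[OF h1, of l] l36 by (simp add: l'_def mult.commute)
  have exp_m: "exp (3 * ln m) = m^3"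
    using m exp_of_nat_mult[of 3 "ln m"] by simp
  have k1: "(real_of_int k)^2 / (2 * l) \<le> 5/2 * ln m"
    using k l36 by (simp add: divide_le_eq mult_ac)
  have ln0: "ln m \<ge> 0" using m by simp
  have "exp ((real_of_int k)^2 / (2 * l)) \<le> exp (3 * ln m)"
    using k1 ln0 by simp
  then have e: "exp ((real_of_int k)^2 / (2 * l)) \<le> m^3"
    by (simp add: exp_m)
  have "(real_of_int k)^2 / (2 * l') \<le> (real_of_int k)^2 / (2 * (5/6 * l))"
    using l'l l36 by (intro divide_left_mono) auto
  also have "\<dots> = 6/5 * ((real_of_int k)^2 / (2 * l))"
    by simp
  also have "\<dots> \<le> 3 * ln m"
    using k1 by simp
  finally have "exp ((real_of_int k)^2 / (2 * l')) \<le> exp (3 * ln m)"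
    by simp
  then have e': "exp ((real_of_int k)^2 / (2 * l')) \<le> m^3"
    by (simp add: exp_m)
  have A: "l \<ge> 1" "24 * exp ((real_of_int k)^2 / (2 * l)) \<le> l"
    using l36 l e by auto
  have B: "l' \<ge> 1" "24 * exp ((real_of_int k)^2 / (2 * l')) \<le> l'"
    using l36 l e' l'l by linarith+
  show "pmf (poisson_walk l) k > 0" "pmf (poisson_walk (l * (1 + h))) k > 0"
    using ln_pmf_poisson_walk(1)[OF A] ln_pmf_poisson_walk(1)[OF B] by (auto simp: l'_def)
  have b1: "24 * exp ((real_of_int k)^2 / (2 * l)) / l \<le> 24 * m^3 / l"
    using e l36 by (intro divide_right_mono) auto
  have b2: "24 * exp ((real_of_int k)^2 / (2 * l')) / l' \<le> 30 * m^3 / l"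
  proof -
    have "24 * exp ((real_of_int k)^2 / (2 * l')) / l' \<le> 24 * m^3 / (5/6 * l)"
      using e' l'l l36 m by (intro frac_le) auto
    also have "\<dots> = 144/5 * (m^3 / l)"
      by simp
    also have "\<dots> \<le> 30 * (m^3 / l)"
      using m l36 by (intro mult_right_mono) auto
    finally show ?thesis by simp
  qed
  have ln_l': "ln (2 * pi * l') = ln (2 * pi * l) + ln (1 + h)"
    using l36 h1 unfolding l'_def mult.assoc[symmetric] by (subst ln_mult) auto
  have quad: "(real_of_int k)^2 / (2 * l) * (h / (1 + h)) = (real_of_int k)^2 / (2 * l) - (real_of_int k)^2 / (2 * l')"
    using l36 h1 by (simp add: l'_def divide_simps) (simp add: algebra_simps)
  have c1: "24 * m^3 / l + 30 * m^3 / l \<le> 60 * m^3 / l"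
    using m l36 by (simp add: add_divide_distrib[symmetric] divide_right_mono)
  show "\<bar>ln (pmf (poisson_walk (l * (1 + h))) k) - ln (pmf (poisson_walk l) k)
       - (- ln (1 + h) / 2 + (real_of_int k)^2 / (2 * l) * (h / (1 + h)))\<bar> \<le> 60 * m^3 / l"
    using ln_pmf_poisson_walk(2)[OF A] ln_pmf_poisson_walk(2)[OF B] b1 b2 ln_l' c1
    unfolding quad l'_def[symmetric] by linarith
qed

text \<open>The logarithms of the weights are summed over the increments. Writing
  \<open>k^2 / (2 * l)\<close> as \<open>(square_dev l k + 1) / 2\<close> separates a deterministic
  drift from a multiple of the centred sum; positivity is carried along so that the logarithms of
  the products split.\<close>

lemma log_likelihood_approx:
  fixes l m h :: real
  assumes m: "m \<ge> 1" and l: "36 * m^3 \<le> l" and h: "\<bar>h\<bar> \<le> 1/6"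
    and "\<And>k. k \<in> set ks \<Longrightarrow> (real_of_int k)^2 \<le> 5 * l * ln m"
  shows "(\<Prod>k\<leftarrow>ks. pmf (poisson_walk l) k) > 0 \<and> (\<Prod>k\<leftarrow>ks. pmf (poisson_walk (l * (1 + h))) k) > 0 \<and>
    \<bar>ln (\<Prod>k\<leftarrow>ks. pmf (poisson_walk (l * (1 + h))) k) - ln (\<Prod>k\<leftarrow>ks. pmf (poisson_walk l) k)
      - (real (length ks) / 2 * (h / (1 + h) - ln (1 + h)) + (\<Sum>k\<leftarrow>ks. square_dev l k) / 2 * (h / (1 + h)))\<bar>
    \<le> real (length ks) * (60 * m^3 / l)"
  using assms(4)
proof (induction ks)
  case Nil
  then show ?case by simp
next
  case (Cons k ks)
  let ?p = "\<lambda>l. pmf (poisson_walk l) k" and ?P = "\<lambda>l. \<Prod>k\<leftarrow>ks. pmf (poisson_walk l) k"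
  have IH: "?P l > 0" "?P (l * (1 + h)) > 0"
    "\<bar>ln (?P (l * (1 + h))) - ln (?P l)
      - (real (length ks) / 2 * (h / (1 + h) - ln (1 + h)) + (\<Sum>k\<leftarrow>ks. square_dev l k) / 2 * (h / (1 + h)))\<bar>
    \<le> real (length ks) * (60 * m^3 / l)"
    using Cons by auto
  have k: "(real_of_int k)^2 \<le> 5 * l * ln m"
    using Cons.prems by simp
  note r = ln_pmf_ratio_poisson_walk[OF m l h k]
  have alg: "- G / 2 + (s + 1) / 2 * F = 1/2 * (F - G) + s / 2 * F" for F G s :: real
    by (simp add: field_simps)
  have "(real_of_int k)^2 / (2 * l) = (square_dev l k + 1) / 2"
    by (simp add: square_dev_def)
  then have "- ln (1 + h) / 2 + (real_of_int k)^2 / (2 * l) * (h / (1 + h)) =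
      1/2 * (h / (1 + h) - ln (1 + h)) + square_dev l k / 2 * (h / (1 + h))"
    by (simp only: alg)
  note r3 = r(3)[unfolded this]
  have sums: "real (length (k # ks)) / 2 * (h / (1 + h) - ln (1 + h)) + (\<Sum>k\<leftarrow>k # ks. square_dev l k) / 2 * (h / (1 + h))
    = (real (length ks) / 2 * (h / (1 + h) - ln (1 + h)) + (\<Sum>k\<leftarrow>ks. square_dev l k) / 2 * (h / (1 + h)))
    + (1/2 * (h / (1 + h) - ln (1 + h)) + square_dev l k / 2 * (h / (1 + h)))"
    by (simp add: add_divide_distrib distrib_right)
  have logs: "ln (\<Prod>k\<leftarrow>k # ks. pmf (poisson_walk l) k) = ln (?p l) + ln (?P l)"
    "ln (\<Prod>k\<leftarrow>k # ks. pmf (poisson_walk (l * (1 + h))) k) = ln (?p (l * (1 + h))) + ln (?P (l * (1 + h)))"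
    using IH r by (simp_all add: ln_mult)
  have len: "real (length (k # ks)) * (60 * m^3 / l) = real (length ks) * (60 * m^3 / l) + 60 * m^3 / l"
    by (simp add: distrib_right add_divide_distrib)
  have "\<bar>ln (\<Prod>k\<leftarrow>k # ks. pmf (poisson_walk (l * (1 + h))) k) - ln (\<Prod>k\<leftarrow>k # ks. pmf (poisson_walk l) k)
      - (real (length (k # ks)) / 2 * (h / (1 + h) - ln (1 + h)) + (\<Sum>k\<leftarrow>k # ks. square_dev l k) / 2 * (h / (1 + h)))\<bar>
    \<le> real (length (k # ks)) * (60 * m^3 / l)"
    unfolding sums logs len using IH(3) r3 by linarith
  then show ?case
    using IH r by simp
qed

theorem theorem3:
  fixes \<Theta> :: "real set" and \<Delta> :: "real \<Rightarrow> real" and \<theta> :: real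
  assumes "open \<Theta>" and "\<Theta> \<subseteq> {0<..}"
    and "filterlim \<Delta> at_top at_top"
    and "filterlim (\<lambda>T. T / \<Delta> T) at_top at_top"
    and "(\<lambda>T. T / \<Delta> T powr (5/4)) \<in> o[at_top](\<lambda>T. ln (T / \<Delta> T) powr (-1/4))"
    and "\<theta> \<in> \<Theta>"
  shows "LAN \<Theta> (\<lambda>T \<eta>. cpp_obs T (\<Delta> T) \<eta>) \<theta> (\<lambda>T. T / \<Delta> T / (2 * \<theta>\<^sup>2))"
proof -

  \<comment> \<open>Reduction to independent Poisson walks\<close>
  define m where "m T = T / \<Delta> T" for T
  define l where "l T = \<theta> * \<Delta> T" for T
  define n where "n T = nat \<lfloor>m T\<rfloor>" for T
  \<comment> \<open>The normalisation contains \<open>m T\<close>, as the prescribed information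
    does, and not the number \<open>n T\<close> of increments; their ratio tends to 1.\<close>
  define \<xi>' where "\<xi>' T ks = (\<Sum>k\<leftarrow>ks. square_dev (l T) k) / sqrt (2 * m T)" for T ks
  define Q where "Q T = replicate_pmf (n T) (poisson_walk (l T))" for T
  define g :: "int list \<Rightarrow> int list" where "g = partial_sums 0"
  have inj: "inj g"
    unfolding g_def by (rule injI) (rule partial_sums_inject)
  have \<theta>: "\<theta> > 0"
    using assms(2,6) by auto
  have obs: "cpp_obs T (\<Delta> T) (\<theta> * c) = map_pmf g (replicate_pmf (n T) (poisson_walk (l T * c)))" for T c
    by (simp add: cpp_obs_def cpp_marginal_eq g_def n_def m_def l_def mult_ac)
  have obs1: "cpp_obs T (\<Delta> T) \<theta> = map_pmf g (Q T)" for T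
    using obs[of T 1] by (simp add: Q_def)

  \<comment> \<open>Limits of the sample size and of the normalised sum\<close>
  have m_top: "filterlim m at_top at_top"
    using assms(4) by (simp add: m_def[abs_def])
  have l_top: "filterlim l at_top at_top"
    unfolding l_def by (rule filterlim_tendsto_pos_mult_at_top[OF tendsto_const \<theta> assms(3)])
  have m1: "\<forall>\<^sub>F T in at_top. m T \<ge> 1"
    using m_top by (simp add: filterlim_at_top)
  have n_le: "\<forall>\<^sub>F T in at_top. real (n T) \<le> m T"
    using m1 by eventually_elim (simp add: n_def)
  have n_lim: "((\<lambda>T. real (n T) / m T) \<longlongrightarrow> 1) at_top"
  proof -
    have "((\<lambda>x. real (nat \<lfloor>x\<rfloor>) / x) \<longlongrightarrow> 1) (at_top :: real filter)"
    proof (rule tendsto_sandwich)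
      show "\<forall>\<^sub>F x in at_top. 1 - 1 / x \<le> real (nat \<lfloor>x\<rfloor>) / x"
        using eventually_ge_at_top[of 1]
      proof eventually_elim
        case (elim x)
        have "x - 1 \<le> real (nat \<lfloor>x\<rfloor>)"
          using elim by linarith
        from divide_right_mono[OF this, of x] elim show ?case
          by (simp add: diff_divide_distrib)
      qed
      show "\<forall>\<^sub>F x in at_top. real (nat \<lfloor>x\<rfloor>) / x \<le> (1::real)"
        using eventually_ge_at_top[of 1] by eventually_elim (simp add: divide_le_eq)
      show "((\<lambda>x. 1 - 1 / x) \<longlongrightarrow> (1::real)) at_top"
        by real_asymp
    qed simp
    from filterlim_compose[OF this m_top] show ?thesis
      by (simp add: n_def)
  qed
  have clt: "conv_in_distr at_top Q \<xi>' std_normal_distribution"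
    unfolding Q_def \<xi>'_def by (rule poisson_walk_clt[OF l_top m_top n_le n_lim])

  \<comment> \<open>Consequences of the growth condition\<close>
  have m4: "((\<lambda>T. 60 * m T^4 / l T) \<longlongrightarrow> 0) at_top"
  proof -
    \<comment> \<open>The fourth power of \<open>?q\<close> is T^4 / \<Delta>^5, which is \<theta>
      times \<open>m T^4 / l T\<close>. For \<open>m T\<close> at least \<open>exp 1\<close> the
      logarithmic factor is at most 1, so \<open>?q\<close> tends to 0. The factor 60 makes the
      expression the local limit error accumulated over all increments.\<close>
    let ?q = "\<lambda>T. T / \<Delta> T powr (5/4)"
    have q0: "(?q \<longlongrightarrow> 0) at_top"
    proof (rule tendstoI)
      fix e :: real assume "e > 0"
      have "\<forall>\<^sub>F T in at_top. norm (?q T) \<le> e / 2 * norm (ln (m T) powr (-1/4))"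
        unfolding m_def using assms(5) \<open>e > 0\<close> by (intro landau_o.smallD) auto
      moreover have "\<forall>\<^sub>F T in at_top. m T \<ge> exp 1"
        using m_top by (simp add: filterlim_at_top)
      ultimately show "\<forall>\<^sub>F T in at_top. dist (?q T) 0 < e"
      proof eventually_elim
        case (elim T)
        have "ln (m T) \<ge> 1"
          using elim(2) by (subst ln_ge_iff) (auto intro: less_le_trans[OF exp_gt_zero])
        then have "ln (m T) powr (-1/4) \<le> ln (m T) powr 0"
          by (intro powr_mono) auto
        then have "norm (ln (m T) powr (-1/4)) \<le> 1"
          using \<open>ln (m T) \<ge> 1\<close> by simp
        then have "e / 2 * norm (ln (m T) powr (-1/4)) \<le> e / 2 * 1"
          using \<open>e > 0\<close> by (intro mult_left_mono) auto
        with elim(1) have "norm (?q T) \<le> e / 2"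
          by linarith
        then have "dist (?q T) 0 \<le> e / 2"
          by (simp only: dist_norm diff_zero)
        with \<open>e > 0\<close> show ?case by linarith
      qed
    qed
    have "((\<lambda>T. 60 / \<theta> * ?q T ^ 4) \<longlongrightarrow> 60 / \<theta> * 0 ^ 4) at_top"
      by (intro tendsto_mult tendsto_const tendsto_power q0)
    moreover have "\<forall>\<^sub>F T in at_top. 60 / \<theta> * ?q T ^ 4 = 60 * m T^4 / l T"
      using filterlim_at_top_dense[THEN iffD1, OF assms(3), rule_format, of 0]
    proof eventually_elim
      case (elim T)
      have "(\<Delta> T powr (5/4)) ^ 4 = \<Delta> T powr 5"
        using elim by (simp add: powr_power)
      also have "\<dots> = \<Delta> T ^ 5"
        using elim by (simp add: powr_numeral)
      finally show ?case
        using elim \<theta> by (simp add: m_def l_def power_divide field_simps eval_nat_numeral)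
    qed
    ultimately show ?thesis
      by (simp add: tendsto_cong)
  qed
  have l36: "\<forall>\<^sub>F T in at_top. 36 * m T^3 \<le> l T"
  proof -
    have "\<forall>\<^sub>F T in at_top. 60 * m T^4 / l T < 1"
      using m4 by (rule order_tendstoD(2)) simp
    moreover have "\<forall>\<^sub>F T in at_top. l T > 0"
      using l_top by (simp add: filterlim_at_top_dense)
    ultimately show ?thesis
      using m1
    proof eventually_elim
      case (elim T)
      have "m T^3 \<le> m T^4"
        using elim(3) by (intro power_increasing) auto
      moreover have "60 * m T^4 < l T"
        using elim(1,2) by (simp add: divide_less_eq)
      moreover have "m T^3 \<ge> 0"
        using elim(3) by simp
      ultimately show ?case by linarith
    qed
  qed
  have I_pos: "\<forall>\<^sub>F T in at_top. m T / (2 * \<theta>\<^sup>2) > 0"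
    using m1 by eventually_elim (use \<theta> in simp)

  \<comment> \<open>The remainder of the log-likelihood expansion\<close>
  have remainder: "\<forall>\<^sub>F T in at_top. \<theta> + v / sqrt (m T / (2 * \<theta>\<^sup>2)) \<in> \<Theta> \<longrightarrow>
      measure_pmf.prob (cpp_obs T (\<Delta> T) \<theta>)
        {\<omega>. \<bar>ln (pmf (cpp_obs T (\<Delta> T) (\<theta> + v / sqrt (m T / (2 * \<theta>\<^sup>2)))) \<omega> / pmf (cpp_obs T (\<Delta> T) \<theta>) \<omega>)
            - (v * \<xi>' T (inv g \<omega>) - v\<^sup>2 / 2)\<bar> > \<epsilon>} < \<epsilon>" if "\<epsilon> > 0" for v \<epsilon> :: real
  proof -
    define h where "h T = v * sqrt (2 / m T)" for T
    \<comment> \<open>Up to the local limit error, the remainder of the expansion is \<open>D T + a T * \<xi>' T\<close>.\<close>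
    define a where "a T = - (sqrt 2 * v^2 / sqrt (m T)) / (1 + h T)" for T
    define D where "D T = real (n T) / 2 * (h T / (1 + h T) - ln (1 + h T)) + v^2 / 2" for T
    have h0: "(h \<longlongrightarrow> 0) at_top"
    proof -
      have "((\<lambda>x::real. v * sqrt (2 / x)) \<longlongrightarrow> v * 0) at_top"
        by (intro tendsto_mult tendsto_const) real_asymp
      from filterlim_compose[OF this m_top] show ?thesis
        by (simp add: h_def[abs_def])
    qed
    have h_small: "\<forall>\<^sub>F T in at_top. \<bar>h T\<bar> < 1/6"
      using tendsto_rabs[OF h0] by (intro order_tendstoD(2)) auto
    have a0: "(a \<longlongrightarrow> 0) at_top"
    proof -
      have "((\<lambda>x::real. sqrt 2 * v^2 / sqrt x) \<longlongrightarrow> 0) at_top"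
        by (rule tendsto_divide_0[OF tendsto_const filterlim_at_top_imp_at_infinity[OF sqrt_at_top]])
      from filterlim_compose[OF this m_top]
      have "((\<lambda>T. - (sqrt 2 * v^2 / sqrt (m T)) / (1 + h T)) \<longlongrightarrow> - 0 / (1 + 0)) at_top"
        by (intro tendsto_divide tendsto_minus tendsto_add tendsto_const h0) simp_all
      then show ?thesis
        by (simp add: a_def[abs_def])
    qed
    have hm: "m T * (h T)^2 = 2 * v^2" if "m T \<ge> 1" for T
      using that by (simp add: h_def power_mult_distrib)
    \<comment> \<open>To second order h/(1 + h) - ln(1 + h) is -h^2/2, and \<open>m * h^2\<close>
      equals \<open>2 * v^2\<close>, so the drift tends to \<open>- v^2 / 2\<close>. The case
      \<open>v = 0\<close> is separate because the argument divides by \<open>h^2\<close>.\<close>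
    have D0: "(D \<longlongrightarrow> 0) at_top"
    proof (cases "v = 0")
      case True
      then show ?thesis by (simp add: D_def[abs_def] h_def)
    next
      case False
      have "((\<lambda>y::real. (y / (1 + y) - ln (1 + y)) / y^2) \<longlongrightarrow> - 1 / 2) (at 0)"
        by real_asymp
      moreover have "filterlim h (at 0) at_top"
        using h0 m1 False by (auto simp: filterlim_at h_def elim!: eventually_mono)
      ultimately have gl: "((\<lambda>T. (h T / (1 + h T) - ln (1 + h T)) / (h T)^2) \<longlongrightarrow> - 1 / 2) at_top"
        by (rule filterlim_compose)
      have "((\<lambda>T. real (n T) / m T * (v^2 * ((h T / (1 + h T) - ln (1 + h T)) / (h T)^2)) + v^2 / 2)
          \<longlongrightarrow> 1 * (v^2 * (- 1 / 2)) + v^2 / 2) at_top"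
        by (intro tendsto_add tendsto_mult tendsto_const n_lim gl)
      moreover have "\<forall>\<^sub>F T in at_top. real (n T) / m T * (v^2 * ((h T / (1 + h T) - ln (1 + h T)) / (h T)^2)) + v^2 / 2 = D T"
        using m1
      proof eventually_elim
        case (elim T)
        have v2: "v^2 = m T * (h T)^2 / 2"
          using hm elim by simp
        have "(h T)^2 \<noteq> 0" "m T \<noteq> 0"
          using False elim by (auto simp: h_def)
        then have "real (n T) / m T * ((m T * (h T)^2 / 2) * (X / (h T)^2)) = real (n T) / 2 * X" for X
          by simp
        then show ?case
          unfolding D_def by (subst v2) simp
      qed
      ultimately show ?thesis
        by (simp add: tendsto_cong)
    qed
    have e2: "\<epsilon> / 2 > 0" "\<epsilon> / 4 > 0" using that by auto
    have err: "\<forall>\<^sub>F T in at_top. 60 * m T^4 / l T < \<epsilon> / 4"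
      using m4 e2 by (intro order_tendstoD(2)) auto
    have D_small: "\<forall>\<^sub>F T in at_top. \<bar>D T\<bar> < \<epsilon> / 4"
      using tendsto_rabs[OF D0] e2 by (intro order_tendstoD(2)) auto
    \<comment> \<open>Each increment exceeds the threshold with probability at most
      \<open>2 * m powr (-5/4)\<close>, and there are at most \<open>m\<close> of them.\<close>
    have tail_small: "\<forall>\<^sub>F T in at_top. 2 * exp (- (ln (m T) / 4)) < \<epsilon> / 2"
    proof -
      have "((\<lambda>x::real. 2 * exp (- (ln x / 4))) \<longlongrightarrow> 0) at_top"
        by real_asymp
      from filterlim_compose[OF this m_top] show ?thesis
        using e2 by (intro order_tendstoD(2)) auto
    qed

    \<comment> \<open>Bounding the remainder for large \<open>T\<close>\<close>
    show ?thesis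
      using m1 l36 n_le h_small err D_small tail_small conv_in_distr_scaled_small[OF clt a0 e2(1)]
    proof eventually_elim
      case (elim T)
      note m = elim(1) and l = elim(2) and n = elim(3)
      have h: "\<bar>h T\<bar> \<le> 1/6" using elim(4) by simp
      have "m T^1 \<le> m T^3"
        using m by (intro power_increasing) auto
      then have lm: "36 * m T \<le> l T"
        using l by simp
      have l_pos: "l T > 0"
        using lm m by linarith
      have \<eta>: "\<theta> + v / sqrt (m T / (2 * \<theta>\<^sup>2)) = \<theta> * (1 + h T)"
      proof -
        have I: "sqrt (m T / (2 * \<theta>\<^sup>2)) = sqrt (m T) / (sqrt 2 * \<theta>)"
          using \<theta> by (simp add: real_sqrt_divide real_sqrt_mult)
        have "h T = v * (sqrt 2 / sqrt (m T))"
          by (simp only: h_def real_sqrt_divide)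
        then show ?thesis
          unfolding I by (simp add: distrib_left)
      qed
      \<comment> \<open>The truncation level for the increments, with \<open>x^2 / (4 * l)\<close>
        equal to 5/4 \<open>ln m\<close>. The Chernoff bound requires \<open>x \<le> 2 * l\<close>,
        which holds because \<open>ln m \<le> m\<close> and \<open>36 * m \<le> l\<close>.\<close>
      define x where "x = sqrt (5 * l T * ln (m T))"
      have lnm: "0 \<le> ln (m T)" "ln (m T) \<le> m T"
        using m ln_le_minus_one[of "m T"] by auto
      have x2: "x^2 = 5 * l T * ln (m T)"
        using lnm l_pos by (simp add: x_def)
      have x: "0 \<le> x" "x \<le> 2 * l T"
      proof -
        show "0 \<le> x" using lnm l_pos by (simp add: x_def)
        have "5 * ln (m T) \<le> 4 * l T"
          using lnm lm m by linarith
        then have "l T * (5 * ln (m T)) \<le> l T * (4 * l T)"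
          using l_pos by (intro mult_left_mono) simp_all
        moreover have "l T * (5 * ln (m T)) = x^2"
          by (simp add: x2)
        moreover have "l T * (4 * l T) = (2 * l T)^2"
          by (simp add: power2_eq_square)
        ultimately have "x^2 \<le> (2 * l T)^2"
          by (simp only:)
        then show "x \<le> 2 * l T"
          using l_pos by (intro power2_le_imp_le[of x "2 * l T"]) simp_all
      qed
      let ?R = "\<lambda>ks. ln (pmf (replicate_pmf (n T) (poisson_walk (l T * (1 + h T)))) ks / pmf (Q T) ks)
          - (v * \<xi>' T ks - v\<^sup>2 / 2)"
      let ?big = "{ks. \<exists>k\<in>set ks. k \<in> {k. \<bar>real_of_int k\<bar> > x}}"
      let ?dev = "{ks. \<bar>a T * \<xi>' T ks\<bar> > \<epsilon> / 2}"
      \<comment> \<open>The accumulated local limit error and the drift \<open>D T\<close> take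
        \<epsilon>/4 each. Exceeding \<epsilon> then forces either a large increment or
        \<open>\<bar>a T * \<xi>' T ks\<bar> > \<epsilon> / 2\<close>, two events of probability
        below \<epsilon>/2 each.\<close>
      have R: "\<bar>?R ks\<bar> \<le> \<epsilon> / 2 + \<bar>a T * \<xi>' T ks\<bar>" if len: "length ks = n T" and "ks \<notin> ?big" for ks
      proof -
        let ?S = "\<Sum>k\<leftarrow>ks. square_dev (l T) k"
        have "(real_of_int k)^2 \<le> 5 * l T * ln (m T)" if "k \<in> set ks" for k
        proof -
          have "\<bar>real_of_int k\<bar> \<le> x"
            using that \<open>ks \<notin> ?big\<close> unfolding mem_Collect_eq by (meson not_less)
          then have "\<bar>real_of_int k\<bar>^2 \<le> x^2"
            by (intro power_mono) auto
          then show ?thesis by (simp add: x2)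
        qed
        note L = log_likelihood_approx[of "m T" "l T" "h T" ks, OF m l h this]
        have S: "?S = sqrt (2 * m T) * \<xi>' T ks"
          using m by (simp add: \<xi>'_def)
        have sq: "sqrt (2 * m T) = sqrt 2 * sqrt (m T)" "sqrt (m T) * sqrt (m T) = m T" "sqrt (m T) > 0"
          using m by (simp_all add: real_sqrt_mult)
        have hs: "h T * sqrt (2 * m T) / 2 = v"
          using sq by (simp add: h_def real_sqrt_divide)
        \<comment> \<open>The linear term turns the centred sum into \<open>v * \<xi>'\<close>,
          since \<open>h * sqrt (2 * m) / 2\<close> equals \<open>v\<close>; the quadratic term
          turns it into \<open>a * \<xi>'\<close>.\<close>
        have frac: "h T / (1 + h T) = h T - (h T)^2 / (1 + h T)"
          using h by (simp add: field_simps power2_eq_square)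
        have a: "a T = - ((h T)^2 / (1 + h T)) * sqrt (2 * m T) / 2"
        proof -
          have "(h T)^2 = 2 * v^2 / m T"
            using hm[of T] m by (simp add: field_simps)
          then have "(h T)^2 * sqrt (2 * m T) / 2 = v^2 * (sqrt 2 * sqrt (m T)) / m T"
            by (simp add: sq)
          also have "\<dots> = sqrt 2 * v^2 / sqrt (m T)"
            using sq(2,3) m by (simp add: field_simps)
          finally show ?thesis
            by (simp add: a_def)
        qed
        have alg: "c * X / 2 * (H - F) = (H * c / 2) * X + (- F * c / 2) * X" for c X F H :: real
          by (simp add: field_simps)
        have "?S / 2 * (h T / (1 + h T)) = (h T * sqrt (2 * m T) / 2) * \<xi>' T ks
            + (- ((h T)^2 / (1 + h T)) * sqrt (2 * m T) / 2) * \<xi>' T ks"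
          unfolding S frac by (rule alg)
        then have main: "real (n T) / 2 * (h T / (1 + h T) - ln (1 + h T)) + ?S / 2 * (h T / (1 + h T))
            = (v * \<xi>' T ks - v\<^sup>2 / 2) + D T + a T * \<xi>' T ks"
          unfolding a[symmetric] hs D_def by simp
        have "real (n T) * (60 * m T^3 / l T) \<le> m T * (60 * m T^3 / l T)"
          using n m l_pos by (intro mult_right_mono) auto
        also have "\<dots> = 60 * m T^4 / l T"
          by (simp add: eval_nat_numeral)
        finally have nb: "real (n T) * (60 * m T^3 / l T) < \<epsilon> / 4"
          using elim(5) by simp
        have "ln (pmf (replicate_pmf (n T) (poisson_walk (l T * (1 + h T)))) ks / pmf (Q T) ks) =
            ln (\<Prod>k\<leftarrow>ks. pmf (poisson_walk (l T * (1 + h T))) k) - ln (\<Prod>k\<leftarrow>ks. pmf (poisson_walk (l T)) k)"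
          using L by (simp add: Q_def pmf_replicate_pmf[OF len] ln_div)
        then show ?thesis
          using L nb elim(6) unfolding len main by linarith
      qed
      have "measure_pmf.prob (Q T) {ks. \<bar>?R ks\<bar> > \<epsilon>} \<le> measure_pmf.prob (Q T) (?big \<union> ?dev)"
      proof (rule measure_pmf.finite_measure_mono_AE)
        \<comment> \<open>The inclusion is needed only on the support, where lists have length
          \<open>n T\<close> and the weights are products.\<close>
        show "AE ks in measure_pmf (Q T). ks \<in> {ks. \<bar>?R ks\<bar> > \<epsilon>} \<longrightarrow> ks \<in> ?big \<union> ?dev"
        proof (rule AE_pmfI, rule impI)
          fix ks assume "ks \<in> set_pmf (Q T)" and *: "ks \<in> {ks. \<bar>?R ks\<bar> > \<epsilon>}"
          then have len: "length ks = n T"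
            by (simp add: Q_def set_replicate_pmf)
          show "ks \<in> ?big \<union> ?dev"
          proof (cases "ks \<in> ?big")
            case False
            from R[OF len this] * have "\<bar>a T * \<xi>' T ks\<bar> > \<epsilon> / 2"
              unfolding mem_Collect_eq by linarith
            then show ?thesis by simp
          qed simp
        qed
      qed simp
      also have "\<dots> \<le> measure_pmf.prob (Q T) ?big + measure_pmf.prob (Q T) ?dev"
        by (intro measure_Un_le) auto
      also have "measure_pmf.prob (Q T) ?big \<le> real (n T) * measure_pmf.prob (poisson_walk (l T)) {k. \<bar>real_of_int k\<bar> > x}"
        unfolding Q_def by (rule prob_replicate_pmf_ex)
      also have "\<dots> \<le> m T * (2 * exp (- (x^2 / (4 * l T))))"
        using n m poisson_walk_tail[OF l_pos x] by (intro mult_mono) auto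
      also have "\<dots> = 2 * exp (- (ln (m T) / 4))"
      proof -
        have "x^2 / (4 * l T) = ln (m T) + ln (m T) / 4"
          unfolding x2 using l_pos by simp
        then have "- (x^2 / (4 * l T)) = - (ln (m T) / 4) + - ln (m T)"
          by linarith
        moreover have "exp (- ln (m T)) = 1 / m T"
          using m by (simp add: exp_minus inverse_eq_divide)
        ultimately have "exp (- (x^2 / (4 * l T))) = exp (- (ln (m T) / 4)) / m T"
          by (simp only: exp_add) simp
        then show ?thesis using m by simp
      qed
      finally have "measure_pmf.prob (Q T) {ks. \<bar>?R ks\<bar> > \<epsilon>} < \<epsilon>"
        using elim(7,8) by linarith
      \<comment> \<open>Injectivity of \<open>g\<close> identifies the weights of a path with those
        of its increments, so the event can be pulled back to \<open>Q T\<close>.\<close>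
      then show ?case
        unfolding \<eta> obs obs1 by (simp add: vimage_def inv_f_f[OF inj] pmf_map_inj'[OF inj])
    qed
  qed
  have conv: "conv_in_distr at_top (\<lambda>T. cpp_obs T (\<Delta> T) \<theta>) (\<lambda>T \<omega>. \<xi>' T (inv g \<omega>)) std_normal_distribution"
    unfolding obs1 by (rule conv_in_distr_map_inj[OF inj clt])
  show ?thesis
    unfolding LAN_def m_def[symmetric]
    using I_pos conv remainder by blast
qed

end
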